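(* In the setting described in the context, let $\epsilon\in(0,1)$ and $c\in\Big[\frac{32}{\epsilon}\max\Big\{\frac{|a_2|^2}{|a_3|+\mathbb{1}_{\{0\}}(a_3)},|a_3|\Big\},\infty\Big)$. Then there exists a real number $C\in(0,\infty)$ such that for all $N\in\mathbb{N}$, $v\in P_N(H)$, $w\in\mathcal{C}([0,T],H_1)$, $t\in[0,T]$ we have that $$\langle v,P_NF(v+w_t)\rangle_{H_{1/2}}+c\Big[\sup_{s\in[0,T]}\|w_s\|_{L^\infty((0,1);\mathbb{R})}^4+1\Big]\langle v,F(v+w_t)\rangle_H$$ $$\le\epsilon\|v\|_{H_1}^2+\Big(|a_1|+\tfrac{|a_2|^2}{3|a_3|+\mathbb{1}_{\{0\}}(a_3)}\Big)\|v\|_{H_{1/2}}^2+c\Big[\sup_{s\in[0,T]}\|w_s\|_{L^\infty((0,1);\mathbb{R})}^4+1\Big]\Big(|a_0|+\tfrac{3|a_1|}2\Big)\|v\|_H^2+C\Big[\sup_{s\in[0,T]}\|w_s\|_{L^\infty((0,1);\mathbb{R})}^8+1\Big].$$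
   Context: Setting: Let $T,\nu\in(0,\infty)$, $a_0,a_1,a_2\in\mathbb{R}$, $a_3\in(-\infty,0]$ with $a_2\mathbb{1}_{\{0\}}(a_3)=0$ (i.e. $a_2=0$ if $a_3=0$), let $H=L^2((0,1);\mathbb{R})$ with its usual inner product and norm, let $e_n\in H$, $n\in\mathbb{N}$, be (the equivalence class of) $x\mapsto\sqrt2\sin(n\pi x)$, let $F\colon L^6((0,1);\mathbb{R})\to H$ be given by $F(v)=\sum_{k=0}^3a_kv^k$, and let $P_n(v)=\sum_{k=1}^n\langle e_k,v\rangle_He_k$ for $n\in\mathbb{N}$, $v\in H$. Let $A\colon D(A)\subseteq H\to H$ be the Laplacian with Dirichlet boundary conditions on $H$ times the real number $\nu$. $(H_r,\langle\cdot,\cdot\rangle_{H_r},\|\cdot\|_{H_r})$, $r\in\mathbb{R}$, is the family of interpolation spaces associated to $-A$; for $r\ge0$, $H_r=D((-A)^r)$ with $\langle v,w\rangle_{H_r}=\langle(-A)^rv,(-A)^rw\rangle_H$. $\mathcal{C}([0,T],H_1)$ is the set of continuous functions from $[0,T]$ to $H_1$, and $\mathbb{1}_{\{0\}}(a_3)$ equals $1$ if $a_3=0$ and $0$ otherwise. *)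

theory Defs
  imports "HOL-Analysis.Analysis" "HOL-Probability.Essential_Supremum"
begin

section \<open>The Hilbert space $H = L^2((0,1);\mathbb{R})$\<close>

abbreviation M01 :: "real measure" where
  "M01 \<equiv> restrict_space lborel {0<..<1}"

definition sq_integrable :: "(real \<Rightarrow> real) \<Rightarrow> bool" where
  "sq_integrable f \<longleftrightarrow> f \<in> borel_measurable M01 \<and> integrable M01 (\<lambda>x. (f x)\<^sup>2)"

definition L2_eq :: "(real \<Rightarrow> real) \<Rightarrow> (real \<Rightarrow> real) \<Rightarrow> bool" where
  "L2_eq f g \<longleftrightarrow> sq_integrable f \<and> sq_integrable g \<and> (AE x in M01. f x = g x)"

lemma sq_integrableD [measurable_dest]: "sq_integrable f \<Longrightarrow> f \<in> borel_measurable M01"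
  by (simp add: sq_integrable_def)

lemma sq_integrable_0 [simp]: "sq_integrable (\<lambda>_. 0)"
  by (simp add: sq_integrable_def)

lemma sq_integrable_mult:
  assumes f: "sq_integrable f" and g: "sq_integrable g"
  shows "integrable M01 (\<lambda>x. f x * g x)"
proof (rule Bochner_Integration.integrable_bound)
  show "integrable M01 (\<lambda>x. (f x)\<^sup>2 + (g x)\<^sup>2)"
    using f g by (simp add: sq_integrable_def)
  show "(\<lambda>x. f x * g x) \<in> borel_measurable M01"
    using f g by (auto simp: sq_integrable_def)
  have "\<bar>u * v\<bar> \<le> u\<^sup>2 + v\<^sup>2" for u v :: real
  proof -
    have "0 \<le> (\<bar>u\<bar> - \<bar>v\<bar>)\<^sup>2 + u\<^sup>2 + v\<^sup>2" by simp
    then show ?thesis by (simp add: power2_eq_square algebra_simps abs_mult)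
  qed
  then show "AE x in M01. norm (f x * g x) \<le> norm ((f x)\<^sup>2 + (g x)\<^sup>2)"
    by simp
qed

lemma sq_integrable_add:
  assumes f: "sq_integrable f" and g: "sq_integrable g"
  shows "sq_integrable (\<lambda>x. f x + g x)"
proof -
  have "integrable M01 (\<lambda>x. (f x)\<^sup>2 + (g x)\<^sup>2 + 2 * (f x * g x))"
    using f g sq_integrable_mult[OF f g] by (simp add: sq_integrable_def)
  then show ?thesis
    using f g by (auto simp: sq_integrable_def power2_sum mult.assoc)
qed

lemma sq_integrable_cmult:
  assumes f: "sq_integrable f" shows "sq_integrable (\<lambda>x. r * f x)"
  using f by (auto simp: sq_integrable_def power_mult_distrib)

lemma sq_integrable_uminus:
  assumes f: "sq_integrable f" shows "sq_integrable (\<lambda>x. - f x)"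
  using f by (auto simp: sq_integrable_def)

lemma sq_integrable_diff:
  assumes f: "sq_integrable f" and g: "sq_integrable g"
  shows "sq_integrable (\<lambda>x. f x - g x)"
  using sq_integrable_add[OF f sq_integrable_uminus[OF g]] by simp

quotient_type L2 = "real \<Rightarrow> real" / partial: L2_eq
proof (rule part_equivpI)
  show "\<exists>f. L2_eq f f"
    by (rule exI[of _ "\<lambda>_. 0"]) (simp add: L2_eq_def)
  show "symp L2_eq"
    by (auto simp: symp_def L2_eq_def eq_commute)
  show "transp L2_eq"
    unfolding transp_def L2_eq_def by (auto elim: eventually_elim2)
qed

instantiation L2 :: real_inner
begin

lift_definition zero_L2 :: L2 is "\<lambda>_. 0"
  by (simp add: L2_eq_def)

lift_definition plus_L2 :: "L2 \<Rightarrow> L2 \<Rightarrow> L2" is "\<lambda>f g x. f x + g x"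
  by (auto simp: L2_eq_def sq_integrable_add elim!: eventually_elim2)

lift_definition minus_L2 :: "L2 \<Rightarrow> L2 \<Rightarrow> L2" is "\<lambda>f g x. f x - g x"
  by (auto simp: L2_eq_def sq_integrable_diff elim!: eventually_elim2)

lift_definition uminus_L2 :: "L2 \<Rightarrow> L2" is "\<lambda>f x. - f x"
  by (auto simp: L2_eq_def sq_integrable_uminus)

lift_definition scaleR_L2 :: "real \<Rightarrow> L2 \<Rightarrow> L2" is "\<lambda>r f x. r * f x"
  by (auto simp: L2_eq_def sq_integrable_cmult)

lift_definition inner_L2 :: "L2 \<Rightarrow> L2 \<Rightarrow> real" is "\<lambda>f g. LINT x|M01. f x * g x"
  by (rule integral_cong_AE) (auto simp: L2_eq_def sq_integrable_def elim!: eventually_elim2)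

definition norm_L2 :: "L2 \<Rightarrow> real" where
  "norm_L2 v = sqrt (inner v v)"

definition sgn_L2 :: "L2 \<Rightarrow> L2" where
  "sgn_L2 v = inverse (norm v) *\<^sub>R v"

definition dist_L2 :: "L2 \<Rightarrow> L2 \<Rightarrow> real" where
  "dist_L2 v w = norm (v - w)"

definition uniformity_L2 :: "(L2 \<times> L2) filter" where
  "uniformity_L2 = (INF e\<in>{0<..}. principal {(x, y). dist x y < e})"

definition open_L2 :: "L2 set \<Rightarrow> bool" where
  "open_L2 U \<longleftrightarrow> (\<forall>x\<in>U. \<forall>\<^sub>F (x', y) in uniformity. x' = x \<longrightarrow> y \<in> U)"

instance
proof
  fix u v w :: L2 and r s :: real
  show "u + v + w = u + (v + w)"
    by transfer (auto simp: L2_eq_def algebra_simps sq_integrable_add)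
  show "u + v = v + u"
    by transfer (auto simp: L2_eq_def algebra_simps sq_integrable_add)
  show "0 + u = u"
    by transfer (auto simp: L2_eq_def)
  show "- u + u = 0"
    by transfer (auto simp: L2_eq_def)
  show "u - v = u + - v"
    by transfer (auto simp: L2_eq_def sq_integrable_diff)
  show "r *\<^sub>R (u + v) = r *\<^sub>R u + r *\<^sub>R v"
    by transfer (auto simp: L2_eq_def algebra_simps sq_integrable_add sq_integrable_cmult)
  show "(r + s) *\<^sub>R u = r *\<^sub>R u + s *\<^sub>R u"
    by transfer (auto simp: L2_eq_def distrib_right sq_integrable_add sq_integrable_cmult)
  show "r *\<^sub>R s *\<^sub>R u = (r * s) *\<^sub>R u"
    by transfer (auto simp: L2_eq_def mult.assoc sq_integrable_cmult)
  show "1 *\<^sub>R u = u"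
    by transfer (auto simp: L2_eq_def)
  show "inner u v = inner v u"
    by transfer (simp add: mult.commute)
  show "inner (u + v) w = inner u w + inner v w"
    by transfer (simp add: L2_eq_def distrib_right sq_integrable_mult)
  show "inner (r *\<^sub>R u) v = r * inner u v"
    by transfer (simp add: mult.assoc)
  show "0 \<le> inner u u"
    by transfer simp
  show "inner u u = 0 \<longleftrightarrow> u = 0"
  proof transfer
    fix f assume "L2_eq f f"
    then have f: "sq_integrable f" by (simp add: L2_eq_def)
    have "(LINT x|M01. f x * f x) = 0 \<longleftrightarrow> (AE x in M01. f x * f x = 0)"
      by (rule integral_nonneg_eq_0_iff_AE) (use sq_integrable_mult[OF f f] in auto)
    then show "(LINT x|M01. f x * f x) = 0 \<longleftrightarrow> L2_eq f (\<lambda>_. 0)"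
      using f by (simp add: L2_eq_def)
  qed
qed (simp_all add: dist_L2_def norm_L2_def sgn_L2_def uniformity_L2_def open_L2_def)

end

lemma L2_eq_refl_iff [simp]: "L2_eq f f \<longleftrightarrow> sq_integrable f"
  by (simp add: L2_eq_def)

lemma abs_L2_eq_iff:
  "sq_integrable f \<Longrightarrow> sq_integrable g \<Longrightarrow> abs_L2 f = abs_L2 g \<longleftrightarrow> (AE x in M01. f x = g x)"
  using Quotient3_rel[OF Quotient3_L2, of f g] by (auto simp: L2_eq_def)

lemma rep_L2_AE: "sq_integrable f \<Longrightarrow> AE x in M01. rep_L2 (abs_L2 f) x = f x"
  using rep_abs_rsp[OF Quotient3_L2, of f f] by (auto simp: L2_eq_def)

lemma sq_integrable_continuous:
  assumes f: "continuous_on {0..1} f" shows "sq_integrable f"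
proof -
  have "continuous_on {0<..<1} f"
    using f by (rule continuous_on_subset) auto
  then have "f \<in> borel_measurable (restrict_space borel {0<..<1})"
    by (rule borel_measurable_continuous_on_restrict)
  then have meas: "f \<in> borel_measurable M01"
    by (simp cong: measurable_cong_sets add: sets_restrict_space)
  have "set_integrable lborel {0..1} (\<lambda>x. (f x)\<^sup>2)"
    by (rule borel_integrable_atLeastAtMost') (intro continuous_intros f)
  then have "set_integrable lborel {0<..<1} (\<lambda>x. (f x)\<^sup>2)"
    by (rule set_integrable_subset) auto
  then show ?thesis
    using meas by (simp add: sq_integrable_def integrable_restrict_space set_integrable_def)
qed

definition e :: "nat \<Rightarrow> L2" where
  "e n = abs_L2 (\<lambda>x. sqrt 2 * sin (real n * pi * x))"

definition P :: "nat \<Rightarrow> L2 \<Rightarrow> L2" where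
  "P n v = (\<Sum>k=1..n. inner (e k) v *\<^sub>R e k)"

text \<open>
  Meaningful on classes of essentially bounded functions only (an infinite essential supremum is
  sent to 0); elements of \<open>H\<^sub>1\<close> are such classes. Likewise real-valued suprema over \<open>[0,T]\<close> of
  powers of \<open>Linf_norm (w s)\<close> are genuine ones because \<open>w\<close> is continuous into \<open>H\<^sub>1\<close>.
\<close>

definition Linf_norm :: "L2 \<Rightarrow> real" where
  "Linf_norm v = real_of_ereal (esssup M01 (\<lambda>x. ereal \<bar>rep_L2 v x\<bar>))"

definition L6 :: "L2 set" where
  "L6 = {v. integrable M01 (\<lambda>x. rep_L2 v x ^ 6)}"

definition F :: "(nat \<Rightarrow> real) \<Rightarrow> L2 \<Rightarrow> L2" where
  "F a = (\<lambda>v\<in>L6. abs_L2 (\<lambda>x. \<Sum>k=0..3. a k * rep_L2 v x ^ k))"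

lemma sq_integrable_rep_L2: "sq_integrable (rep_L2 v)"
  using Quotient3_rep_reflp[OF Quotient3_L2, of v] by simp

lemma sq_integrable_F:
  assumes "v \<in> L6" shows "sq_integrable (\<lambda>x. \<Sum>k=0..3. a k * rep_L2 v x ^ k)"
proof -
  have meas: "rep_L2 v \<in> borel_measurable M01"
    by (rule sq_integrableD[OF sq_integrable_rep_L2])
  have bound: "(y ^ k)\<^sup>2 \<le> 1 + y ^ 6" if "k \<le> 3" for y :: real and k
  proof -
    have "(y ^ k)\<^sup>2 = \<bar>y ^ k\<bar>\<^sup>2"
      by (rule power2_abs[symmetric])
    also have "\<dots> = \<bar>y\<bar> ^ (k * 2)"
      by (simp only: power_abs power_mult)
    finally have *: "(y ^ k)\<^sup>2 = \<bar>y\<bar> ^ (k * 2)" "y ^ 6 = \<bar>y\<bar> ^ 6"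
      by (simp_all only: power_even_abs_numeral even_numeral)
    show ?thesis
    proof (cases "\<bar>y\<bar> \<le> 1")
      case True
      then have "\<bar>y\<bar> ^ (k * 2) \<le> 1" by (intro power_le_one) auto
      moreover have "0 \<le> \<bar>y\<bar> ^ 6" by (intro zero_le_power) auto
      ultimately show ?thesis unfolding * by linarith
    next
      case False
      then have "\<bar>y\<bar> ^ (k * 2) \<le> \<bar>y\<bar> ^ 6" using that by (intro power_increasing) auto
      then show ?thesis unfolding * by linarith
    qed
  qed
  have pow: "sq_integrable (\<lambda>x. rep_L2 v x ^ k)" if k: "k \<le> 3" for k
    unfolding sq_integrable_def
  proof (rule conjI[OF _ Bochner_Integration.integrable_bound])
    interpret finite_measure M01
      by (rule finite_measureI) (simp add: emeasure_restrict_space space_restrict_space)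
    show "integrable M01 (\<lambda>x. 1 + rep_L2 v x ^ 6)"
      using assms by (intro Bochner_Integration.integrable_add integrable_const) (simp add: L6_def)
    show "AE x in M01. norm ((rep_L2 v x ^ k)\<^sup>2) \<le> norm (1 + rep_L2 v x ^ 6)"
      by (rule AE_I2) (use bound[OF k] in \<open>simp add: abs_of_nonneg\<close>)
    show "(\<lambda>x. rep_L2 v x ^ k) \<in> borel_measurable M01"
      by (rule borel_measurable_power[OF meas])
    then show "(\<lambda>x. (rep_L2 v x ^ k)\<^sup>2) \<in> borel_measurable M01"
      by (rule borel_measurable_power)
  qed
  have "sq_integrable (\<lambda>x. \<Sum>k\<in>K. a k * rep_L2 v x ^ k)" if "finite K" "K \<subseteq> {0..3}" for K
    using that
  proof (induction K)
    case (insert k K)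
    then have "sq_integrable (\<lambda>x. a k * rep_L2 v x ^ k)"
      and "sq_integrable (\<lambda>x. \<Sum>k\<in>K. a k * rep_L2 v x ^ k)"
      by (auto intro: sq_integrable_cmult[OF pow])
    from sq_integrable_add[OF this] insert show ?case by simp
  qed simp
  then show ?thesis by blast
qed


section \<open>The Dirichlet Laplacian and its interpolation spaces\<close>

text \<open>
  The graph of \<open>A\<close>. An element of \<open>H\<^sup>2 \<inter> H\<^sup>1\<^sub>0\<close> is a class having a representative \<open>\<phi>\<close> that is
  continuously differentiable on the closed interval, vanishes at both end points and whose
  derivative \<open>\<phi>'\<close> is an indefinite integral of some \<open>g \<in> L\<^sup>2\<close>; this \<open>g\<close> is the second weak derivative.
\<close>

definition A_graph :: "real \<Rightarrow> (L2 \<times> L2) set" where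
  "A_graph \<nu> = {(abs_L2 \<phi>, \<nu> *\<^sub>R abs_L2 g) | \<phi> \<phi>' g.
     sq_integrable g \<and> \<phi> 0 = 0 \<and> \<phi> 1 = 0 \<and>
     (\<forall>x\<in>{0..1}. (\<phi> has_real_derivative \<phi>' x) (at x within {0..1})) \<and>
     (\<forall>x\<in>{0..1}. \<phi>' x = \<phi>' 0 + (LINT y:{0<..<x}|lborel. g y))}"

definition eigenval :: "real \<Rightarrow> nat \<Rightarrow> real" where
  "eigenval \<nu> n = (THE l. (e n, - l *\<^sub>R e n) \<in> A_graph \<nu>)"

lemma eigenpair_iff:
  assumes \<nu>: "0 < \<nu>" and n: "0 < n"
  shows "(e n, - l *\<^sub>R e n) \<in> A_graph \<nu> \<longleftrightarrow> l = \<nu> * (real n * pi)\<^sup>2"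
proof -
  define s where "s = (\<lambda>x. sqrt 2 * sin (real n * pi * x))"
  define s' where "s' = (\<lambda>x. sqrt 2 * (real n * pi) * cos (real n * pi * x))"
  have ds: "(s has_real_derivative s' x) (at x within S)" for x S
    unfolding s_def s'_def by (auto intro!: derivative_eq_intros)
  have ds': "(s' has_real_derivative - (real n * pi)\<^sup>2 * s x) (at x within S)" for x S
    unfolding s_def s'_def by (auto intro!: derivative_eq_intros simp: power2_eq_square)
  have cs: "continuous_on S s" for S
    unfolding s_def by (intro continuous_intros)
  have sq: "sq_integrable s"
    by (rule sq_integrable_continuous[OF cs])
  have en: "e n = abs_L2 s"
    by (simp add: e_def s_def)
  have scale: "r *\<^sub>R abs_L2 f = abs_L2 (\<lambda>x. r * f x)" if "sq_integrable f" for r f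
    using that by (intro scaleR_L2.abs_eq) simp
  have int: "(LINT y:{0<..<x}|lborel. k * s y) = - k / (real n * pi)\<^sup>2 * (s' x - s' 0)"
    if "0 \<le> x" for k x
  proof -
    have "(LBINT y=ereal 0..ereal x. k * s y)
        = - k / (real n * pi)\<^sup>2 * s' x - (- k / (real n * pi)\<^sup>2 * s' 0)"
    proof (rule interval_integral_FTC_finite)
      show "continuous_on {min 0 x..max 0 x} (\<lambda>y. k * s y)"
        by (intro continuous_intros cs)
      fix y
      have "((\<lambda>x. - k / (real n * pi)\<^sup>2 * s' x) has_real_derivative
          - k / (real n * pi)\<^sup>2 * (- (real n * pi)\<^sup>2 * s y)) (at y within {min 0 x..max 0 x})"
        by (intro DERIV_cmult ds')
      then show "((\<lambda>x. - k / (real n * pi)\<^sup>2 * s' x) has_vector_derivative k * s y)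
          (at y within {min 0 x..max 0 x})"
        using n by (simp add: has_real_derivative_iff_has_vector_derivative)
    qed
    moreover have "(LBINT y=ereal 0..ereal x. k * s y) = (LINT y:{0<..<x}|lborel. k * s y)"
      using that by (subst interval_integral_Ioo) auto
    ultimately show ?thesis
      by (simp add: right_diff_distrib)
  qed
  show ?thesis
  proof
    assume l: "l = \<nu> * (real n * pi)\<^sup>2"
    define g where "g = (\<lambda>x. - (real n * pi)\<^sup>2 * s x)"
    have "- l *\<^sub>R e n = \<nu> *\<^sub>R abs_L2 g"
      unfolding l en g_def by (subst scale[OF sq, symmetric]) simp
    moreover have "s' x = s' 0 + (LINT y:{0<..<x}|lborel. g y)" if "x \<in> {0..1}" for x
      using that n by (subst g_def, subst int) auto
    moreover have "s 0 = 0" "s 1 = 0"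
      by (auto simp: s_def)
    moreover have "sq_integrable g"
      unfolding g_def by (rule sq_integrable_cmult[OF sq])
    ultimately show "(e n, - l *\<^sub>R e n) \<in> A_graph \<nu>"
      unfolding A_graph_def en using ds by blast
  next
    assume "(e n, - l *\<^sub>R e n) \<in> A_graph \<nu>"
    then obtain \<phi> \<phi>' g where e\<phi>: "abs_L2 s = abs_L2 \<phi>"
      and eg: "- l *\<^sub>R abs_L2 s = \<nu> *\<^sub>R abs_L2 g"
      and g: "sq_integrable g" and bc: "\<phi> 0 = 0" "\<phi> 1 = 0"
      and d\<phi>: "\<And>x. x \<in> {0..1} \<Longrightarrow> (\<phi> has_real_derivative \<phi>' x) (at x within {0..1})"
      and \<phi>': "\<And>x. x \<in> {0..1} \<Longrightarrow> \<phi>' x = \<phi>' 0 + (LINT y:{0<..<x}|lborel. g y)"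
      unfolding A_graph_def en by blast
    have c\<phi>: "continuous_on {0..1} \<phi>"
      using d\<phi> by (rule DERIV_continuous_on)
    have "AE x in M01. s x = \<phi> x"
      using e\<phi> abs_L2_eq_iff[OF sq sq_integrable_continuous[OF c\<phi>]] by simp
    then have ae: "AE x in lborel. x \<in> {0<..<1} \<longrightarrow> x \<in> {x \<in> {0..1}. \<phi> x - s x = 0}"
      by (subst (asm) AE_restrict_space_iff) auto
    have "closed {x \<in> {0..1}. \<phi> x - s x = 0}"
      by (intro continuous_closed_preimage_constant continuous_intros c\<phi> cs)
    then have "x \<in> {x \<in> {0..1}. \<phi> x - s x = 0}" if "x \<in> {0<..<1}" for x
      using mem_closed_if_AE_lebesgue_open[OF open_greaterThanLessThan _ AE_completion[OF ae] that] by blast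
    then have eq: "\<phi> x = s x" if "x \<in> {0..1}" for x
      using that bc by (cases "x = 0 \<or> x = 1") (auto simp: s_def)
    have eq': "\<phi>' x = s' x" if x: "x \<in> {0..1}" for x
    proof -
      have "(s has_real_derivative \<phi>' x) (at x within {0..1})"
        using d\<phi>[OF x] unfolding has_field_derivative_def
        by (rule has_derivative_transform[OF x, rotated]) (simp add: eq)
      then show ?thesis
        using x ds[of x "{0..1}"] vector_derivative_unique_within_closed_interval[of 0 1 x s "\<phi>' x" "s' x"]
        by (simp add: has_real_derivative_iff_has_vector_derivative)
    qed
    have "AE x in M01. - l * s x = \<nu> * g x"
      using eg abs_L2_eq_iff[OF sq_integrable_cmult[OF sq] sq_integrable_cmult[OF g], of "- l" \<nu>]
      unfolding scale[OF sq] scale[OF g] by blast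
    then have aeg: "AE x in lborel. x \<in> {0<..<1} \<longrightarrow> - l * s x = \<nu> * g x"
      by (subst (asm) AE_restrict_space_iff) auto
    define x where "x = 1 / real n"
    have x: "x \<in> {0..1}" "real n * pi * x = pi"
      using n by (auto simp: x_def)
    have gm: "(\<lambda>y. indicator {0<..<1} y * g y) \<in> borel_measurable lborel"
      using sq_integrableD[OF g] by (subst (asm) borel_measurable_restrict_space_iff) auto
    have "(LINT y:{0<..<x}|lborel. g y) = (LINT y:{0<..<x}|lborel. indicator {0<..<1} y * g y)"
      by (rule set_lebesgue_integral_cong) (use x in auto)
    also have "\<dots> = (LINT y:{0<..<x}|lborel. (- l / \<nu>) * s y)"
      unfolding set_lebesgue_integral_def
    proof (rule integral_cong_AE)
      show "(\<lambda>y. indicat_real {0<..<x} y *\<^sub>R (indicator {0<..<1} y * g y)) \<in> borel_measurable lborel"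
        using gm by measurable
      have "s \<in> borel_measurable lborel"
        using borel_measurable_continuous_onI[OF cs] by simp
      then show "(\<lambda>y. indicat_real {0<..<x} y *\<^sub>R (- l / \<nu> * s y)) \<in> borel_measurable lborel"
        by measurable
      show "AE y in lborel. indicat_real {0<..<x} y *\<^sub>R (indicator {0<..<1} y * g y)
          = indicat_real {0<..<x} y *\<^sub>R (- l / \<nu> * s y)"
        using aeg by eventually_elim (use x \<nu> in \<open>auto simp: indicator_def field_simps\<close>)
    qed
    also have "\<dots> = l / \<nu> / (real n * pi)\<^sup>2 * (s' x - s' 0)"
      using x by (subst int) auto
    finally have "s' x - s' 0 = l / \<nu> / (real n * pi)\<^sup>2 * (s' x - s' 0)"
      using \<phi>'[OF x(1)] eq'[OF x(1)] eq'[of 0] by simp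
    moreover have "s' x - s' 0 \<noteq> 0"
      using n unfolding s'_def x(2) by simp
    ultimately have "l / \<nu> / (real n * pi)\<^sup>2 = 1"
      using mult_cancel_right1 by blast
    then show "l = \<nu> * (real n * pi)\<^sup>2"
      using n \<nu> by (simp add: field_simps)
  qed
qed

lemma eigenval_eq:
  assumes "0 < \<nu>" "0 < n" shows "eigenval \<nu> n = \<nu> * (real n * pi)\<^sup>2"
  unfolding eigenval_def eigenpair_iff[OF assms] by (rule the_equality) auto

text \<open>
  Fractional powers of \<open>-A\<close> through its orthonormal eigenbasis \<open>e 1, e 2, \<dots>\<close>. The domain consists
  of those \<open>v\<close> for which the series converges in \<open>H\<close>; since its terms are pairwise orthogonal, this
  is square summability of the coefficients.
\<close>

definition H_space :: "real \<Rightarrow> real \<Rightarrow> L2 set" where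
  "H_space \<nu> r = {v. summable (\<lambda>n. (eigenval \<nu> (Suc n) powr r * inner (e (Suc n)) v) *\<^sub>R e (Suc n))}"

definition frac_pow :: "real \<Rightarrow> real \<Rightarrow> L2 \<Rightarrow> L2" where
  "frac_pow \<nu> r v = (\<Sum>n. (eigenval \<nu> (Suc n) powr r * inner (e (Suc n)) v) *\<^sub>R e (Suc n))"

definition H_inner :: "real \<Rightarrow> real \<Rightarrow> L2 \<Rightarrow> L2 \<Rightarrow> real" where
  "H_inner \<nu> r v w = inner (frac_pow \<nu> r v) (frac_pow \<nu> r w)"

definition H_norm :: "real \<Rightarrow> real \<Rightarrow> L2 \<Rightarrow> real" where
  "H_norm \<nu> r v = sqrt (H_inner \<nu> r v v)"

definition C_space :: "real \<Rightarrow> real \<Rightarrow> real \<Rightarrow> (real \<Rightarrow> L2) set" where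
  "C_space \<nu> T r = {w. (\<forall>t\<in>{0..T}. w t \<in> H_space \<nu> r) \<and>
     (\<forall>t\<in>{0..T}. ((\<lambda>s. H_norm \<nu> r (w s - w t)) \<longlongrightarrow> 0) (at t within {0..T}))}"

end

theory Submission
  imports Defs "HOL-Probability.Probability_Measure"
begin

text \<open>
  Write \<open>v\<close> as a trigonometric polynomial \<open>V\<close> and \<open>-A v\<close> as \<open>Z = -\<nu> V''\<close>. Since \<open>P N\<close> is
  self-adjoint and \<open>-A v\<close> again lies in its range, the projection disappears:
  \<open>\<langle>v, P\<^sub>N F(v + w)\<rangle>\<close> in \<open>H\<^sub>1\<^sub>/\<^sub>2\<close> is the integral of \<open>Z F(V + w)\<close> (\<open>H_inner_half_P\<close>).

  Split \<open>F(V + w) = p(V) + R\<close> with \<open>p(y) = a\<^sub>1 y + a\<^sub>2 y\<^sup>2 + a\<^sub>3 y\<^sup>3\<close>. The part \<open>p\<close> vanishes at \<open>0\<close>, so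
  one integration by parts turns the integral of \<open>Z p(V)\<close> into that of \<open>\<nu> (V')\<^sup>2 p'(V)\<close>. Because
  \<open>a\<^sub>3 \<le> 0\<close>, the quadratic polynomial \<open>p'\<close> is bounded above, and its bound is exactly the constant
  in front of the \<open>H\<^sub>1\<^sub>/\<^sub>2\<close>-norm (\<open>P_range_representative\<close>, \<open>cubic_derivative_upper_bound\<close>).

  What remains is a pointwise matter (\<open>pointwise_estimate\<close>). By Young's inequality
  \<open>Z R \<le> \<epsilon> Z\<^sup>2 + R\<^sup>2 / (4 \<epsilon>)\<close>. The worst term of \<open>R\<^sup>2\<close> is \<open>9 a\<^sub>3\<^sup>2 v\<^sup>4 w\<^sup>2\<close>; it has the same degree in \<open>v\<close>
  as the dissipative term \<open>-c K |a\<^sub>3| v\<^sup>4\<close> hidden in \<open>c K v F(v + w)\<close>, where \<open>K = sup |w|\<^sup>4 + 1\<close>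
  dominates \<open>w\<^sup>2\<close>. The lower bound \<open>c \<ge> 32 |a\<^sub>3| / \<epsilon>\<close> lets half of the dissipation absorb it, and
  the other half absorbs the lower order terms of \<open>v F(v + w)\<close>. All that is left over is a multiple
  of \<open>K\<^sup>2\<close>, hence of \<open>sup |w|\<^sup>8 + 1\<close>.

  The pointwise estimate can be integrated only if \<open>|w\<^sub>t(x)|\<^sup>4\<close> is really dominated by the supremum
  over time (\<open>C_space_SUP_Linf_norm\<close>), which requires that \<open>H\<^sub>1\<close> embeds into \<open>L\<^sup>\<infinity>\<close>. As \<open>H\<^sub>1\<close> is
  given by sine coefficients alone, this embedding rests on the completeness of the sine system
  in \<open>L\<^sup>2\<close>, which is obtained from the Weierstrass approximation theorem in the variable
  \<open>cos(\<pi> x)\<close> (\<open>AE_eq_0_if_sine_coefficients_eq_0\<close>).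
\<close>

section \<open>Integration over the unit interval\<close>

lemma prob_space_M01: "prob_space M01"
  by (rule prob_spaceI) (simp add: emeasure_restrict_space space_restrict_space)

interpretation M01: prob_space M01
  by (rule prob_space_M01)

lemma measure_M01 [simp]: "measure M01 {0<..<1} = 1"
  using M01.prob_space by (simp add: space_restrict_space)

lemma integrable_sq_integrable:
  assumes "sq_integrable f" shows "integrable M01 f"
  using sq_integrable_mult[OF assms sq_integrable_continuous[of "\<lambda>_. 1"]] by simp

lemma integrable_mult_bounded:
  fixes f g :: "real \<Rightarrow> real"
  assumes f: "integrable M01 f" and g: "g \<in> borel_measurable M01"
    and B: "\<And>x. x \<in> {0<..<1} \<Longrightarrow> \<bar>g x\<bar> \<le> B"
  shows "integrable M01 (\<lambda>x. f x * g x)"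
proof (rule Bochner_Integration.integrable_bound)
  show "integrable M01 (\<lambda>x. B * \<bar>f x\<bar>)"
    using f by simp
  show "(\<lambda>x. f x * g x) \<in> borel_measurable M01"
    using f g by (intro borel_measurable_times) auto
  show "AE x in M01. norm (f x * g x) \<le> norm (B * \<bar>f x\<bar>)"
  proof (rule AE_I2)
    fix x assume "x \<in> space M01"
    then have "\<bar>g x\<bar> \<le> \<bar>B\<bar>"
      using B[of x] by (simp add: space_restrict_space)
    then show "norm (f x * g x) \<le> norm (B * \<bar>f x\<bar>)"
      using mult_left_mono[of "\<bar>g x\<bar>" "\<bar>B\<bar>" "\<bar>f x\<bar>"] by (simp add: abs_mult mult.commute)
  qed
qed

lemma measurable_M01_continuous:
  fixes f :: "real \<Rightarrow> real"
  shows "continuous_on {0..1} f \<Longrightarrow> f \<in> borel_measurable M01"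
  by (rule sq_integrableD[OF sq_integrable_continuous])

lemma abs_rep_L2: "abs_L2 (rep_L2 v) = v"
  by (rule Quotient3_abs_rep[OF Quotient3_L2])

lemma rep_L2_add_AE: "AE x in M01. rep_L2 (u + v) x = rep_L2 u x + rep_L2 v x"
proof -
  have "u + v = abs_L2 (\<lambda>x. rep_L2 u x + rep_L2 v x)"
    using plus_L2.abs_eq[of "rep_L2 u" "rep_L2 v"] by (simp add: sq_integrable_rep_L2 abs_rep_L2)
  then show ?thesis
    using rep_L2_AE[OF sq_integrable_add[OF sq_integrable_rep_L2 sq_integrable_rep_L2], of u v] by simp
qed

lemma inner_abs_L2:
  assumes "sq_integrable f" "sq_integrable g"
  shows "inner (abs_L2 f) (abs_L2 g) = (LINT x|M01. f x * g x)"
  using assms by (simp add: inner_L2.abs_eq)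

lemma LINT_M01_derivative:
  assumes g: "continuous_on {0..1} g"
    and G: "\<And>x. x \<in> {0..1} \<Longrightarrow> (G has_real_derivative g x) (at x within {0..1})"
  shows "(LINT x|M01. g x) = G 1 - G 0"
proof -
  have "(LBINT x=ereal 0..ereal 1. g x) = G 1 - G 0"
    using g G by (intro interval_integral_FTC_finite)
      (auto simp: has_real_derivative_iff_has_vector_derivative[symmetric])
  moreover have "(LBINT x=ereal 0..ereal 1. g x) = (LINT x:{0<..<1}|lborel. g x)"
    by (subst interval_integral_Ioo) auto
  ultimately show ?thesis
    by (simp add: integral_restrict_space set_lebesgue_integral_def)
qed

section \<open>Completeness of the sine system\<close>

text \<open>
  The densities given by the positive and the negative part of \<open>h\<close> are finite measures
  that agree on the generating system of half-lines, so they are equal, and the two parts agree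
  almost everywhere.
\<close>

lemma AE_eq_0_if_LINT_half_lines_eq_0:
  fixes h :: "real \<Rightarrow> real"
  assumes h: "integrable lborel h"
    and 0: "\<And>t. (LINT x|lborel. indicator {t<..} x * h x) = 0"
  shows "AE x in lborel. h x = 0"
proof -
  have [measurable]: "h \<in> borel_measurable borel"
    using h by simp
  have fin: "(\<integral>\<^sup>+x. ennreal (indicator A x * f x) \<partial>lborel) < \<infinity>"
    if "f = h \<or> f = (\<lambda>x. - h x)" "A \<in> sets borel" for A f
  proof -
    have "integrable lborel (\<lambda>x. indicator A x * f x)"
      using that h integrable_mult_indicator[of A lborel f] by auto
    then show ?thesis
      by (metis infinity_ennreal_def integrableE real_integrable_def less_top)
  qed
  have dens: "emeasure (density lborel (\<lambda>x. ennreal (f x))) A = (\<integral>\<^sup>+x. ennreal (indicator A x * f x) \<partial>lborel)"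
    if "f \<in> borel_measurable borel" "A \<in> sets borel" for f :: "real \<Rightarrow> real" and A
    using that by (subst emeasure_density) (auto intro!: nn_integral_cong simp: indicator_def)
  have eq: "(\<integral>\<^sup>+x. ennreal (indicator {t<..} x * h x) \<partial>lborel) = (\<integral>\<^sup>+x. ennreal (indicator {t<..} x * - h x) \<partial>lborel)" for t
  proof -
    have "integrable lborel (\<lambda>x. indicator {t<..} x * h x)"
      using h integrable_mult_indicator[of "{t<..}" lborel h] by auto
    from real_lebesgue_integral_def[OF this] 0[of t]
    have "enn2real (\<integral>\<^sup>+x. ennreal (indicator {t<..} x * h x) \<partial>lborel) = enn2real (\<integral>\<^sup>+x. ennreal (indicator {t<..} x * - h x) \<partial>lborel)"
      by simp
    then show ?thesis
      using fin[of h "{t<..}"] fin[of "\<lambda>x. - h x" "{t<..}"]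
      by (metis ennreal_enn2real greaterThan_borel infinity_ennreal_def)
  qed
  have "density lborel (\<lambda>x. ennreal (h x)) = density lborel (\<lambda>x. ennreal (- h x))"
  proof (rule measure_eqI_lessThan)
    fix t :: real
    show "emeasure (density lborel (\<lambda>x. ennreal (h x))) {t<..} < \<infinity>"
      using fin[of h "{t<..}"] by (simp add: dens)
    show "emeasure (density lborel (\<lambda>x. ennreal (h x))) {t<..}
        = emeasure (density lborel (\<lambda>x. ennreal (- h x))) {t<..}"
      using eq[of t] by (simp add: dens)
  qed simp_all
  then have "AE x in lborel. ennreal (h x) = ennreal (- h x)"
    using fin[of h UNIV] by (subst (asm) finite_density_unique) auto
  then show ?thesis
  proof eventually_elim
    case (elim x)
    have "h x \<le> 0" if "0 \<le> h x"
      using elim that by (simp add: ennreal_neg)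
    moreover have "0 \<le> h x" if "h x \<le> 0"
      using elim[symmetric] that by (simp add: ennreal_neg)
    ultimately show ?case by linarith
  qed
qed

text \<open>
  Since \<open>cos(\<pi> x)\<close> maps the closed unit interval bijectively onto
  \<open>[-1,1]\<close>, every continuous \<open>g\<close> is a continuous function of
  \<open>cos(\<pi> x)\<close>, hence a uniform limit of polynomials in \<open>cos(\<pi> x)\<close>.
\<close>

lemma LINT_M01_mult_continuous_eq_0:
  assumes h: "integrable M01 h"
    and poly: "\<And>p. real_polynomial_function p \<Longrightarrow> (LINT x|M01. h x * p (cos (pi * x))) = 0"
    and g: "continuous_on {0..1} g"
  shows "(LINT x|M01. h x * g x) = 0"
proof -
  have [measurable]: "h \<in> borel_measurable M01"
    using h by simp
  define G where "G y = g (arccos y / pi)" for y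
  have G: "continuous_on {-1..1} G"
    unfolding G_def
    by (rule continuous_on_compose2[OF g])
      (auto intro!: continuous_intros continuous_on_arccos' simp: divide_simps arccos_lbound arccos_ubound)
  have Gcos: "G (cos (pi * x)) = g x" if "x \<in> {0..1}" for x
    using that by (simp add: G_def arccos_cos)
  have sp: "space M01 = {0<..<1}"
    by (simp add: space_restrict_space)
  have bnd: "\<bar>LINT x|M01. h x * g x\<bar> \<le> r * (LINT x|M01. \<bar>h x\<bar>)" if "0 < r" for r
  proof -
    obtain p where p: "real_polynomial_function p" and pG: "\<And>y. y \<in> {-1..1} \<Longrightarrow> \<bar>G y - p y\<bar> < r"
      using Stone_Weierstrass_real_polynomial_function[OF _ G \<open>0 < r\<close>] by auto
    have cp: "continuous_on S p" for S
      using p by (metis continuous_on_polymonial_function real_polynomial_function_eq)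
    have gm: "g \<in> borel_measurable M01"
      using g by (rule measurable_M01_continuous)
    have pm: "(\<lambda>x. p (cos (pi * x))) \<in> borel_measurable M01"
      by (rule measurable_M01_continuous)
        (intro continuous_on_compose2[OF cp[of UNIV]] continuous_intros, auto)
    have close: "\<bar>g x - p (cos (pi * x))\<bar> \<le> r" if "x \<in> {0<..<1}" for x
      using pG[of "cos (pi * x)"] Gcos[of x] that by auto
    have int1: "integrable M01 (\<lambda>x. h x * (g x - p (cos (pi * x))))"
      using h borel_measurable_diff[OF gm pm] close by (rule integrable_mult_bounded)
    obtain B where B: "\<And>y. y \<in> {-1..1} \<Longrightarrow> \<bar>p y\<bar> \<le> B"
      using compact_imp_bounded[OF compact_continuous_image[OF cp[of "{-1..1}"] compact_Icc]]
      unfolding bounded_real by blast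
    have int2: "integrable M01 (\<lambda>x. h x * p (cos (pi * x)))"
      using h pm by (rule integrable_mult_bounded[where B = B]) (use B in auto)
    have pt: "\<bar>h x * (g x - p (cos (pi * x)))\<bar> \<le> r * \<bar>h x\<bar>" if "x \<in> {0<..<1}" for x
      using mult_left_mono[OF close[OF that] abs_ge_zero[of "h x"]]
      by (simp add: abs_mult mult.commute[of r])
    have "(LINT x|M01. h x * g x) = (LINT x|M01. h x * (g x - p (cos (pi * x))) + h x * p (cos (pi * x)))"
      by (simp add: algebra_simps)
    also have "\<dots> = (LINT x|M01. h x * (g x - p (cos (pi * x))))"
      using int1 int2 poly[OF p] by (subst Bochner_Integration.integral_add) auto
    finally have "\<bar>LINT x|M01. h x * g x\<bar> \<le> (LINT x|M01. \<bar>h x * (g x - p (cos (pi * x)))\<bar>)"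
      by simp
    also have "\<dots> \<le> (LINT x|M01. r * \<bar>h x\<bar>)"
      using h int1 pt by (intro integral_mono) (auto simp: sp)
    finally show ?thesis by simp
  qed
  show ?thesis
  proof (rule ccontr)
    assume "(LINT x|M01. h x * g x) \<noteq> 0"
    define J where "J = (LINT x|M01. \<bar>h x\<bar>)"
    have J: "0 \<le> J" unfolding J_def by (rule Bochner_Integration.integral_nonneg) simp
    define q where "q = \<bar>LINT x|M01. h x * g x\<bar>"
    have q: "0 < q" using \<open>_ \<noteq> 0\<close> by (simp add: q_def)
    \<comment> \<open>Adding one to the integral \<open>J\<close> covers the case \<open>J = 0\<close>.\<close>
    have "q \<le> q / (2 * (J + 1)) * J"
      unfolding q_def J_def
      by (rule bnd) (use q J in \<open>simp add: J_def[symmetric] q_def[symmetric]\<close>)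
    also have "\<dots> = q / 2 * (J / (J + 1))"
      by simp
    also have "\<dots> \<le> q / 2 * 1"
      using q J by (intro mult_left_mono) auto
    finally show False using q by simp
  qed
qed

text \<open>
  The identity \<open>2 sin(n y) cos(y) = sin((n + 1) y) + sin((n - 1) y)\<close> trades one factor
  \<open>cos(y)\<close> for a shift of the frequency, so induction over \<open>k\<close> removes all
  cosines.
\<close>

lemma sin_mult_cos_power_orthogonal:
  assumes f: "integrable M01 f"
    and ort: "\<And>n. (LINT x|M01. f x * sin (real n * (pi * x))) = 0"
  shows "(LINT x|M01. f x * (sin (real n * (pi * x)) * cos (pi * x) ^ k)) = 0"
proof (induction k arbitrary: n)
  case 0
  then show ?case using ort by simp
next
  case (Suc k)
  have int: "integrable M01 (\<lambda>x. f x * (sin (real n * (pi * x)) * cos (pi * x) ^ k))" for n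
  proof (rule integrable_mult_bounded[OF f])
    show "(\<lambda>x. sin (real n * (pi * x)) * cos (pi * x) ^ k) \<in> borel_measurable M01"
      by (rule measurable_M01_continuous) (intro continuous_intros)
    show "\<bar>sin (real n * (pi * x)) * cos (pi * x) ^ k\<bar> \<le> 1" for x
      by (simp add: abs_mult power_abs mult_le_one power_le_one)
  qed
  show ?case
  proof (cases n)
    case (Suc m)
    have *: "sin (real n * y) * cos y ^ Suc k
      = (sin (real (m + 2) * y) * cos y ^ k + sin (real m * y) * cos y ^ k) / 2" for y
    proof -
      have "real (m + 2) * y = real n * y + y" "real m * y = real n * y - y"
        by (simp_all add: Suc algebra_simps)
      then show ?thesis by (simp only: sin_add sin_diff) (simp add: algebra_simps)
    qed
    have "(LINT x|M01. f x * (sin (real n * (pi * x)) * cos (pi * x) ^ Suc k))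
        = (LINT x|M01. (f x * (sin (real (m + 2) * (pi * x)) * cos (pi * x) ^ k)
            + f x * (sin (real m * (pi * x)) * cos (pi * x) ^ k)) / 2)"
      unfolding * by (simp add: distrib_left)
    also have "\<dots> = 0"
      using int[of "m + 2"] int[of m] Suc.IH[of "m + 2"] Suc.IH[of m]
      by (subst integral_divide_zero, subst Bochner_Integration.integral_add) simp_all
    finally show ?thesis .
  qed simp
qed

text \<open>
  With \<open>h(x) = f(x) sin(\<pi> x)\<close>, orthogonality to all sines says that
  \<open>h\<close> is orthogonal to all polynomials in \<open>cos(\<pi> x)\<close>, hence to all
  continuous functions, hence to indicators of half-lines. So \<open>h\<close> vanishes, and
  \<open>sin(\<pi> x)\<close> is positive on the open interval.
\<close>

lemma AE_eq_0_if_sine_coefficients_eq_0: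
  assumes f: "integrable M01 f"
    and ort: "\<And>n. (LINT x|M01. f x * sin (real n * (pi * x))) = 0"
  shows "AE x in M01. f x = 0"
proof -
  define h where "h x = f x * sin (pi * x)" for x
  have h: "integrable M01 h"
    unfolding h_def
  proof (rule integrable_mult_bounded[OF f])
    show "(\<lambda>x. sin (pi * x)) \<in> borel_measurable M01"
      by (rule measurable_M01_continuous) (intro continuous_intros)
    show "\<bar>sin (pi * x)\<bar> \<le> 1" for x by simp
  qed
  then have hm: "h \<in> borel_measurable M01" by simp
  have poly0: "(LINT x|M01. h x * p (cos (pi * x))) = 0" if p: "real_polynomial_function p" for p
  proof -
    obtain b N where pb: "p = (\<lambda>y. \<Sum>i\<le>N. b i * y ^ i)"
      using p unfolding real_polynomial_function_iff_sum by auto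
    have int: "integrable M01 (\<lambda>x. f x * (sin (real 1 * (pi * x)) * cos (pi * x) ^ k))" for k
    proof (rule integrable_mult_bounded[OF f])
      show "(\<lambda>x. sin (real 1 * (pi * x)) * cos (pi * x) ^ k) \<in> borel_measurable M01"
        by (rule measurable_M01_continuous) (intro continuous_intros)
      show "\<bar>sin (real 1 * (pi * x)) * cos (pi * x) ^ k\<bar> \<le> 1" for x
        by (simp add: abs_mult power_abs mult_le_one power_le_one)
    qed
    have "(LINT x|M01. h x * p (cos (pi * x)))
        = (LINT x|M01. (\<Sum>i\<le>N. b i * (f x * (sin (real 1 * (pi * x)) * cos (pi * x) ^ i))))"
      by (simp add: h_def pb sum_distrib_left algebra_simps)
    also have "\<dots> = (\<Sum>i\<le>N. b i * (LINT x|M01. f x * (sin (real 1 * (pi * x)) * cos (pi * x) ^ i)))"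
      using int by (subst Bochner_Integration.integral_sum) auto
    also have "\<dots> = 0"
      using sin_mult_cos_power_orthogonal[OF f ort, of 1] by simp
    finally show ?thesis .
  qed
  have cont0: "(LINT x|M01. h x * g x) = 0" if "continuous_on {0..1} g" for g
    using h poly0 that by (rule LINT_M01_mult_continuous_eq_0)
  have ind0: "(LINT x|M01. h x * indicator {t<..} x) = 0" for t
  proof -
    \<comment> \<open>Continuous ramps that increase to the indicator of the half-line.\<close>
    define g where "g n x = min 1 (max 0 (real n * (x - t)))" for n x
    have gc: "continuous_on {0..1} (g n)" for n
      unfolding g_def by (intro continuous_intros)
    have lim: "(\<lambda>n. LINT x|M01. h x * g n x) \<longlonglongrightarrow> (LINT x|M01. h x * indicator {t<..} x)"
    proof (rule integral_dominated_convergence)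
      show "integrable M01 (\<lambda>x. \<bar>h x\<bar>)" using h by simp
      have "(\<lambda>x. indicator {t<..} x :: real) \<in> borel_measurable M01"
        by (rule measurable_restrict_space1) simp
      then show "(\<lambda>x. h x * indicator {t<..} x) \<in> borel_measurable M01"
        using hm by measurable
      show "(\<lambda>x. h x * g n x) \<in> borel_measurable M01" for n
        using hm measurable_M01_continuous[OF gc] by measurable
      show "AE x in M01. norm (h x * g n x) \<le> \<bar>h x\<bar>" for n
        by (rule AE_I2) (auto simp: abs_mult g_def intro!: mult_left_le)
      have "(\<lambda>n. g n x) \<longlonglongrightarrow> indicator {t<..} x" for x
      proof (cases "x > t")
        case True
        have "eventually (\<lambda>n. real n > 1 / (x - t)) sequentially"
          using filterlim_at_top_dense filterlim_real_sequentially by blast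
        then have "eventually (\<lambda>n. g n x = indicator {t<..} x) sequentially"
          by eventually_elim (use True in \<open>auto simp: g_def field_simps\<close>)
        then show ?thesis by (rule tendsto_eventually)
      next
        case False
        then have "g n x = 0" for n
          by (auto simp: g_def mult_nonneg_nonpos)
        then show ?thesis using False by simp
      qed
      then show "AE x in M01. (\<lambda>n. h x * g n x) \<longlonglongrightarrow> h x * indicator {t<..} x"
        by (auto intro!: tendsto_mult_left)
    qed
    have "(LINT x|M01. h x * g n x) = 0" for n
      by (rule cont0[OF gc])
    then show ?thesis
      using LIMSEQ_unique[OF lim, of 0] by simp
  qed
  have "AE x in lborel. indicator {0<..<1} x * h x = 0"
  proof (rule AE_eq_0_if_LINT_half_lines_eq_0)
    show "integrable lborel (\<lambda>x. indicator {0<..<1} x * h x)"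
      using h by (simp add: integrable_restrict_space)
    show "(LINT x|lborel. indicator {t<..} x * (indicator {0<..<1} x * h x)) = 0" for t
      using ind0[of t] by (simp add: integral_restrict_space mult_ac)
  qed
  then have "AE x in lborel. x \<in> {0<..<1} \<longrightarrow> f x = 0"
  proof eventually_elim
    case (elim x)
    have "0 < sin (pi * x)" if "x \<in> {0<..<1}"
      using that by (intro sin_gt_zero) auto
    with elim show ?case by (auto simp: h_def)
  qed
  then show ?thesis
    by (subst AE_restrict_space_iff) auto
qed

section \<open>The orthonormal sine basis\<close>

definition e_fun :: "nat \<Rightarrow> real \<Rightarrow> real" where
  "e_fun n x = sqrt 2 * sin (real n * pi * x)"

lemma e_eq_abs_L2: "e n = abs_L2 (e_fun n)"
  by (simp add: e_def e_fun_def[abs_def])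

lemma continuous_on_e_fun: "continuous_on S (e_fun n)"
  unfolding e_fun_def by (intro continuous_intros)

lemma sq_integrable_e_fun: "sq_integrable (e_fun n)"
  by (rule sq_integrable_continuous[OF continuous_on_e_fun])

lemma abs_e_fun_le: "\<bar>e_fun n x\<bar> \<le> sqrt 2"
  by (simp add: e_fun_def abs_mult)

lemma LINT_cos: "(LINT x|M01. cos (real_of_int m * pi * x)) = (if m = 0 then 1 else 0)"
proof (cases "m = 0")
  case False
  have "(LINT x|M01. cos (real_of_int m * pi * x))
      = sin (real_of_int m * pi * 1) / (real_of_int m * pi) - sin (real_of_int m * pi * 0) / (real_of_int m * pi)"
    by (rule LINT_M01_derivative)
      (use False in \<open>auto intro!: continuous_intros derivative_eq_intros\<close>)
  also have "sin (real_of_int m * pi * 1) = 0"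
    by (auto simp: sin_zero_iff_int2)
  finally show ?thesis using False by simp
qed (simp add: space_restrict_space)

lemma inner_e_e:
  assumes "0 < j" "0 < k"
  shows "inner (e j) (e k) = (if j = k then 1 else 0)"
proof -
  have "e_fun j x * e_fun k x = cos (real_of_int (int j - int k) * pi * x) - cos (real_of_int (int j + int k) * pi * x)" for x
  proof -
    have "e_fun j x * e_fun k x = 2 * (sin (real j * pi * x) * sin (real k * pi * x))"
      by (simp add: e_fun_def)
    also have "\<dots> = cos (real j * pi * x - real k * pi * x) - cos (real j * pi * x + real k * pi * x)"
      by (simp add: sin_times_sin)
    also have "\<dots> = cos (real_of_int (int j - int k) * pi * x) - cos (real_of_int (int j + int k) * pi * x)"
      by (simp add: algebra_simps)
    finally show ?thesis .
  qed
  then have "inner (e j) (e k) = (LINT x|M01. cos (real_of_int (int j - int k) * pi * x) - cos (real_of_int (int j + int k) * pi * x))"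
    by (simp add: e_eq_abs_L2 inner_abs_L2 sq_integrable_e_fun)
  also have "\<dots> = (LINT x|M01. cos (real_of_int (int j - int k) * pi * x)) - (LINT x|M01. cos (real_of_int (int j + int k) * pi * x))"
    by (intro Bochner_Integration.integral_diff integrable_sq_integrable sq_integrable_continuous continuous_intros)
  also have "\<dots> = (if j = k then 1 else 0)"
    unfolding LINT_cos using assms by simp
  finally show ?thesis .
qed

lemma inner_e_eq_LINT:
  assumes "sq_integrable f"
  shows "inner (e n) (abs_L2 f) = (LINT x|M01. e_fun n x * f x)"
  using assms by (simp add: e_eq_abs_L2 inner_abs_L2 sq_integrable_e_fun)

lemma L2_eqI_sine_coefficients:
  assumes "\<And>n. 0 < n \<Longrightarrow> inner (e n) u = inner (e n) v"
  shows "u = v"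
proof -
  define f where "f = rep_L2 (u - v)"
  have f: "sq_integrable f" and uv: "u - v = abs_L2 f"
    by (simp_all add: f_def sq_integrable_rep_L2 abs_rep_L2)
  have "(LINT x|M01. f x * sin (real n * (pi * x))) = 0" for n
  proof (cases "n = 0")
    case False
    have "(LINT x|M01. e_fun n x * f x) = 0"
      using assms[of n] False inner_e_eq_LINT[OF f, of n] by (simp add: uv[symmetric] inner_diff_right)
    moreover have "e_fun n x * f x = sqrt 2 * (f x * sin (real n * (pi * x)))" for x
      by (simp add: e_fun_def mult_ac)
    ultimately show ?thesis by simp
  qed simp
  then have "AE x in M01. f x = 0"
    by (rule AE_eq_0_if_sine_coefficients_eq_0[OF integrable_sq_integrable[OF f]])
  then have "abs_L2 f = abs_L2 (\<lambda>_. 0)"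
    by (subst abs_L2_eq_iff) (simp_all add: f)
  then show ?thesis
    using uv by (simp add: zero_L2_def[symmetric])
qed

section \<open>The embedding of $H_1$ into $L^\infty$\<close>

lemma eigenval_pos: "0 < \<nu> \<Longrightarrow> 0 < n \<Longrightarrow> 0 < eigenval \<nu> n"
  by (simp add: eigenval_eq)

lemma inner_e_frac_pow:
  assumes "v \<in> H_space \<nu> r"
  shows "inner (e (Suc m)) (frac_pow \<nu> r v) = eigenval \<nu> (Suc m) powr r * inner (e (Suc m)) v"
proof -
  define X where "X n = (eigenval \<nu> (Suc n) powr r * inner (e (Suc n)) v) *\<^sub>R e (Suc n)" for n
  have "summable X"
    using assms by (simp add: H_space_def X_def[abs_def])
  then have "inner (e (Suc m)) (suminf X) = (\<Sum>n. inner (e (Suc m)) (X n))"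
    by (rule bounded_linear.suminf[OF bounded_linear_inner_right])
  also have "\<dots> = (\<Sum>n. if n = m then eigenval \<nu> (Suc m) powr r * inner (e (Suc m)) v else 0)"
    by (rule suminf_cong) (simp add: X_def inner_e_e)
  also have "\<dots> = eigenval \<nu> (Suc m) powr r * inner (e (Suc m)) v"
    using sums_single[of m "\<lambda>_. eigenval \<nu> (Suc m) powr r * inner (e (Suc m)) v"] by (simp add: sums_iff)
  finally show ?thesis by (simp add: frac_pow_def X_def[abs_def])
qed

lemma H_norm_eq: "H_norm \<nu> r v = norm (frac_pow \<nu> r v)"
  by (simp add: H_norm_def H_inner_def norm_eq_sqrt_inner)

lemma norm_e: "0 < n \<Longrightarrow> norm (e n) = 1"
  by (simp add: norm_eq_sqrt_inner inner_e_e)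

lemma abs_inner_e_le:
  assumes "0 < \<nu>" "v \<in> H_space \<nu> 1"
  shows "\<bar>inner (e (Suc n)) v\<bar> \<le> H_norm \<nu> 1 v / eigenval \<nu> (Suc n)"
proof -
  have "eigenval \<nu> (Suc n) * \<bar>inner (e (Suc n)) v\<bar> = \<bar>inner (e (Suc n)) (frac_pow \<nu> 1 v)\<bar>"
    using inner_e_frac_pow[OF assms(2), of n] eigenval_pos[OF assms(1), of "Suc n"] by (simp add: abs_mult)
  also have "\<dots> \<le> H_norm \<nu> 1 v"
    using Cauchy_Schwarz_ineq2[of "e (Suc n)" "frac_pow \<nu> 1 v"] by (simp add: norm_e H_norm_eq)
  finally show ?thesis
    using eigenval_pos[OF assms(1), of "Suc n"] by (simp add: field_simps)
qed

text \<open>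
  The norm of the embedding of \<open>H\<^sub>1\<close> into \<open>L\<^sup>\<infinity>\<close> is
  at most this sum: the \<open>n\<close>-th sine coefficient is at most the
  \<open>H\<^sub>1\<close>-norm divided by the \<open>n\<close>-th eigenvalue, and the basis
  functions are bounded by \<open>sqrt 2\<close>.
\<close>

definition sup_embedding_const :: "real \<Rightarrow> real" where
  "sup_embedding_const \<nu> = (\<Sum>n. sqrt 2 / eigenval \<nu> (Suc n))"

lemma summable_inverse_eigenval:
  assumes "0 < \<nu>" shows "summable (\<lambda>n. sqrt 2 / eigenval \<nu> (Suc n))"
proof -
  have "summable (\<lambda>n. 1 / real (Suc n) ^ 2)"
    using inverse_power_summable[of 2, where 'a = real] summable_Suc_iff[of "\<lambda>n. 1 / real n ^ 2"]
    by (simp add: inverse_eq_divide)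
  then have "summable (\<lambda>n. sqrt 2 / (\<nu> * pi\<^sup>2) * (1 / real (Suc n) ^ 2))"
    by (rule summable_mult)
  moreover have "sqrt 2 / (\<nu> * pi\<^sup>2) * (1 / real (Suc n) ^ 2) = sqrt 2 / eigenval \<nu> (Suc n)" for n
    using assms by (simp add: eigenval_eq power_mult_distrib)
  ultimately show ?thesis by simp
qed

text \<open>
  The sine series of \<open>v\<close> is dominated by a summable sequence, so it converges uniformly
  to a continuous function \<open>g\<close>. Integrating termwise shows that \<open>g\<close> has
  the same sine coefficients as \<open>v\<close>, and completeness identifies the two classes.
\<close>

lemma H1_AE_bounded:
  assumes \<nu>: "0 < \<nu>" and v: "v \<in> H_space \<nu> 1"
  shows "AE x in M01. \<bar>rep_L2 v x\<bar> \<le> sup_embedding_const \<nu> * H_norm \<nu> 1 v"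
proof -
  define b where "b n = inner (e (Suc n)) v" for n
  define q where "q n = H_norm \<nu> 1 v * (sqrt 2 / eigenval \<nu> (Suc n))" for n
  define g where "g x = (\<Sum>n. b n * e_fun (Suc n) x)" for x
  have q: "summable q"
    unfolding q_def by (intro summable_mult summable_inverse_eigenval \<nu>)
  have "H_norm \<nu> 1 v \<ge> 0" by (simp add: H_norm_eq)
  have bq: "norm (b n * e_fun (Suc n) x) \<le> q n" for n x
  proof -
    have "norm (b n * e_fun (Suc n) x) = \<bar>b n\<bar> * \<bar>e_fun (Suc n) x\<bar>"
      by (simp add: abs_mult)
    also have "\<dots> \<le> H_norm \<nu> 1 v / eigenval \<nu> (Suc n) * sqrt 2"
      unfolding b_def using abs_inner_e_le[OF \<nu> v] eigenval_pos[OF \<nu>, of "Suc n"] \<open>H_norm \<nu> 1 v \<ge> 0\<close>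
      by (intro mult_mono abs_e_fun_le) auto
    finally show ?thesis by (simp add: q_def mult_ac)
  qed
  have "uniform_limit {0..1} (\<lambda>n x. \<Sum>i<n. b i * e_fun (Suc i) x) g sequentially"
    unfolding g_def by (rule Weierstrass_m_test[OF bq q])
  then have gc: "continuous_on {0..1} g"
    by (rule uniform_limit_theorem[rotated])
      (auto intro!: always_eventually continuous_intros continuous_on_e_fun)
  have gb: "\<bar>g x\<bar> \<le> sup_embedding_const \<nu> * H_norm \<nu> 1 v" for x
  proof -
    have "norm (g x) \<le> suminf q"
      unfolding g_def by (rule norm_suminf_le[OF bq q])
    also have "suminf q = sup_embedding_const \<nu> * H_norm \<nu> 1 v"
      unfolding q_def sup_embedding_const_def
      using suminf_mult[OF summable_inverse_eigenval[OF \<nu>], of "H_norm \<nu> 1 v"] by (simp add: mult.commute)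
    finally show ?thesis by simp
  qed
  have gs: "sq_integrable g" by (rule sq_integrable_continuous[OF gc])
  have "v = abs_L2 g"
  proof (rule L2_eqI_sine_coefficients)
    fix k :: nat assume k: "0 < k"
    define Y where "Y n x = e_fun k x * (b n * e_fun (Suc n) x)" for n x
    have Yc: "continuous_on {0..1} (Y n)" for n
      unfolding Y_def by (intro continuous_intros continuous_on_e_fun)
    have Yi: "integrable M01 (Y n)" for n
      by (rule integrable_sq_integrable[OF sq_integrable_continuous[OF Yc]])
    have Yq: "norm (Y n x) \<le> sqrt 2 * q n" for n x
      unfolding Y_def norm_mult[of "e_fun k x"]
      using abs_e_fun_le[of k x] bq[of n x] by (intro mult_mono) auto
    have sq: "summable (\<lambda>n. sqrt 2 * q n)" by (intro summable_mult q)
    have sY: "summable (\<lambda>n. norm (Y n x))" for x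
      by (rule summable_comparison_test'[OF sq]) (simp add: Yq[simplified])
    have sI: "summable (\<lambda>n. LINT x|M01. norm (Y n x))"
    proof (rule summable_comparison_test'[OF sq])
      fix n
      have "(LINT x|M01. norm (Y n x)) \<le> (LINT x|M01. sqrt 2 * q n)"
        using Yi[of n] Yq by (intro integral_mono) auto
      then show "norm (LINT x|M01. norm (Y n x)) \<le> sqrt 2 * q n"
        by (simp add: space_restrict_space)
    qed
    have "e_fun k x * g x = (\<Sum>n. Y n x)" for x
    proof -
      have "summable (\<lambda>n. b n * e_fun (Suc n) x)"
        using q bq by (rule summable_comparison_test')
      then show ?thesis
        unfolding g_def Y_def by (rule suminf_mult[symmetric])
    qed
    then have "inner (e k) (abs_L2 g) = (LINT x|M01. (\<Sum>n. Y n x))"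
      by (simp add: inner_e_eq_LINT[OF gs])
    also have "\<dots> = (\<Sum>n. LINT x|M01. Y n x)"
      by (rule integral_suminf[OF Yi AE_I2[OF sY] sI])
    also have "\<dots> = (\<Sum>n. if n = k - 1 then inner (e k) v else 0)"
    proof (rule suminf_cong)
      fix n
      have "(LINT x|M01. Y n x) = b n * inner (e k) (e (Suc n))"
        unfolding e_eq_abs_L2[of "Suc n"] inner_e_eq_LINT[OF sq_integrable_e_fun] Y_def
        by (simp add: mult.left_commute)
      then show "(LINT x|M01. Y n x) = (if n = k - 1 then inner (e k) v else 0)"
        using k by (auto simp: inner_e_e b_def)
    qed
    also have "\<dots> = inner (e k) v"
      using sums_single[of "k - 1" "\<lambda>_. inner (e k) v"] by (simp add: sums_iff)
    finally show "inner (e k) v = inner (e k) (abs_L2 g)" ..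
  qed
  then have "AE x in M01. rep_L2 v x = g x"
    using rep_L2_AE[OF gs] by simp
  then show ?thesis
    by eventually_elim (simp add: gb)
qed

text \<open>
  An essential bound guarantees that the essential supremum is a finite real number, so that its
  conversion from the extended reals is faithful.
\<close>

lemma Linf_norm_bounds:
  assumes bound: "AE x in M01. \<bar>rep_L2 v x\<bar> \<le> B" and "0 \<le> B"
  shows "AE x in M01. \<bar>rep_L2 v x\<bar> \<le> Linf_norm v" "0 \<le> Linf_norm v" "Linf_norm v \<le> B"
proof -
  define E where "E = esssup M01 (\<lambda>x. ereal \<bar>rep_L2 v x\<bar>)"
  have [measurable]: "rep_L2 v \<in> borel_measurable M01"
    by (rule sq_integrableD[OF sq_integrable_rep_L2])
  have EB: "E \<le> ereal B"
    unfolding E_def using bound by (intro esssup_I) auto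
  have AE: "AE x in M01. ereal \<bar>rep_L2 v x\<bar> \<le> E"
    unfolding E_def by (rule esssup_AE)
  have "AE x in M01. 0 \<le> E"
    using AE by eventually_elim (metis abs_ge_zero ereal_less_eq(5) order_trans)
  then have E0: "0 \<le> E" by (simp add: M01.AE_const)
  then obtain r where r: "E = ereal r"
    using EB by (cases E) auto
  have L: "Linf_norm v = r"
    unfolding Linf_norm_def using r by (simp add: E_def)
  show "AE x in M01. \<bar>rep_L2 v x\<bar> \<le> Linf_norm v"
    using AE by (simp add: r L)
  show "0 \<le> Linf_norm v" "Linf_norm v \<le> B"
    using E0 EB by (simp_all add: r L)
qed

lemma sup_embedding_const_nonneg: "0 < \<nu> \<Longrightarrow> 0 \<le> sup_embedding_const \<nu>"
  unfolding sup_embedding_const_def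
  by (intro suminf_nonneg summable_inverse_eigenval) (auto simp: less_imp_le[OF eigenval_pos])

lemma H1_Linf_norm:
  assumes "0 < \<nu>" "v \<in> H_space \<nu> 1"
  shows "AE x in M01. \<bar>rep_L2 v x\<bar> \<le> Linf_norm v" "0 \<le> Linf_norm v"
    "Linf_norm v \<le> sup_embedding_const \<nu> * H_norm \<nu> 1 v"
  using Linf_norm_bounds[OF H1_AE_bounded[OF assms]] sup_embedding_const_nonneg[OF assms(1)]
  by (simp_all add: H_norm_eq)

text \<open>
  On the domain of the fractional power both series converge, so they may be subtracted termwise.
  This makes the \<open>H\<^sub>r\<close>-distance of two elements the
  \<open>L\<^sup>2\<close>-distance of their images.
\<close>

lemma frac_pow_diff:
  assumes "u \<in> H_space \<nu> r" "v \<in> H_space \<nu> r"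
  shows "frac_pow \<nu> r (u - v) = frac_pow \<nu> r u - frac_pow \<nu> r v"
  using assms unfolding frac_pow_def H_space_def
  by (simp add: suminf_diff inner_diff_right right_diff_distrib scaleR_left_diff_distrib)

text \<open>
  A curve that is continuous into \<open>H\<^sub>r\<close> becomes, after applying the fractional
  power, a continuous curve in \<open>L\<^sup>2\<close> over a compact interval, and its image is
  bounded.
\<close>

lemma C_space_bounded:
  assumes w: "w \<in> C_space \<nu> T r"
  obtains B where "\<And>s. s \<in> {0..T} \<Longrightarrow> H_norm \<nu> r (w s) \<le> B"
proof -
  have H: "w s \<in> H_space \<nu> r" if "s \<in> {0..T}" for s
    using w that by (simp add: C_space_def)
  have "continuous_on {0..T} (\<lambda>s. frac_pow \<nu> r (w s))"
    unfolding continuous_on_def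
  proof
    fix t assume t: "t \<in> {0..T}"
    have "((\<lambda>s. H_norm \<nu> r (w s - w t)) \<longlongrightarrow> 0) (at t within {0..T})"
      using w t by (simp add: C_space_def)
    moreover have "\<forall>\<^sub>F s in at t within {0..T}.
        H_norm \<nu> r (w s - w t) = norm (frac_pow \<nu> r (w s) - frac_pow \<nu> r (w t))"
      unfolding eventually_at_filter
      by (intro always_eventually) (use t in \<open>auto simp: H_norm_eq frac_pow_diff H\<close>)
    ultimately have "((\<lambda>s. norm (frac_pow \<nu> r (w s) - frac_pow \<nu> r (w t))) \<longlongrightarrow> 0) (at t within {0..T})"
      by (rule Lim_transform_eventually)
    then show "((\<lambda>s. frac_pow \<nu> r (w s)) \<longlongrightarrow> frac_pow \<nu> r (w t)) (at t within {0..T})"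
      by (subst Lim_null) (simp add: tendsto_norm_zero_iff)
  qed
  then have "bounded ((\<lambda>s. frac_pow \<nu> r (w s)) ` {0..T})"
    by (intro compact_imp_bounded compact_continuous_image compact_Icc)
  then obtain B where "\<And>s. s \<in> {0..T} \<Longrightarrow> norm (frac_pow \<nu> r (w s)) \<le> B"
    unfolding bounded_iff by blast
  then show ?thesis
    by (intro that) (simp add: H_norm_eq)
qed

text \<open>
  Boundedness in \<open>H\<^sub>1\<close> and the embedding make the sets of powers bounded above,
  so the real suprema are genuine upper bounds.
\<close>

lemma C_space_SUP_Linf_norm:
  assumes \<nu>: "0 < \<nu>" and T: "0 < T" and w: "w \<in> C_space \<nu> T 1" and t: "t \<in> {0..T}"
  shows "AE x in M01. rep_L2 (w t) x ^ 4 \<le> (SUP s\<in>{0..T}. Linf_norm (w s) ^ 4)"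
    and "0 \<le> (SUP s\<in>{0..T}. Linf_norm (w s) ^ 4)"
    and "(SUP s\<in>{0..T}. Linf_norm (w s) ^ 4)\<^sup>2 \<le> (SUP s\<in>{0..T}. Linf_norm (w s) ^ 8)"
proof -
  have H: "w s \<in> H_space \<nu> 1" if "s \<in> {0..T}" for s
    using w that by (simp add: C_space_def)
  note L = H1_Linf_norm[OF \<nu> H]
  obtain B where B: "\<And>s. s \<in> {0..T} \<Longrightarrow> H_norm \<nu> 1 (w s) \<le> B"
    using C_space_bounded[OF w] by blast
  have "Linf_norm (w s) \<le> sup_embedding_const \<nu> * B" if "s \<in> {0..T}" for s
    by (rule order_trans[OF L(3)[OF that] mult_left_mono[OF B[OF that] sup_embedding_const_nonneg[OF \<nu>]]])
  then have bdd: "bdd_above ((\<lambda>s. Linf_norm (w s) ^ n) ` {0..T})" for n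
    using L(2) by (intro bdd_aboveI[of _ "(sup_embedding_const \<nu> * B) ^ n"]) (auto intro!: power_mono)
  have up: "Linf_norm (w s) ^ n \<le> (SUP s\<in>{0..T}. Linf_norm (w s) ^ n)" if "s \<in> {0..T}" for s n
    using bdd that by (intro cSUP_upper)
  show "AE x in M01. rep_L2 (w t) x ^ 4 \<le> (SUP s\<in>{0..T}. Linf_norm (w s) ^ 4)"
    using L(1)[OF t]
  proof eventually_elim
    case (elim x)
    then have "\<bar>rep_L2 (w t) x\<bar> ^ 4 \<le> Linf_norm (w t) ^ 4"
      by (intro power_mono) auto
    with up[OF t, of 4] show ?case by simp
  qed
  show nn: "0 \<le> (SUP s\<in>{0..T}. Linf_norm (w s) ^ 4)"
    using up[OF t, of 4] L(2)[OF t] by (meson order_trans zero_le_power)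
  have "(SUP s\<in>{0..T}. Linf_norm (w s) ^ 4) \<le> sqrt (SUP s\<in>{0..T}. Linf_norm (w s) ^ 8)"
  proof (rule cSUP_least)
    show "{0..T} \<noteq> {}" using T by simp
    fix s assume "s \<in> {0..T}"
    then show "Linf_norm (w s) ^ 4 \<le> sqrt (SUP s\<in>{0..T}. Linf_norm (w s) ^ 8)"
      using up[of s 8] by (intro real_le_rsqrt) (simp flip: power_mult)
  qed
  moreover have "0 \<le> (SUP s\<in>{0..T}. Linf_norm (w s) ^ 8)"
    using up[OF t, of 8] L(2)[OF t] by (meson order_trans zero_le_power)
  ultimately show "(SUP s\<in>{0..T}. Linf_norm (w s) ^ 4)\<^sup>2 \<le> (SUP s\<in>{0..T}. Linf_norm (w s) ^ 8)"
    using nn by (metis power_mono real_sqrt_pow2)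
qed

section \<open>Galerkin spaces and integration by parts\<close>

lemma inner_e_P:
  assumes "0 < j"
  shows "inner (e j) (P N v) = (if j \<le> N then inner (e j) v else 0)"
proof -
  have "inner (e j) (P N v) = (\<Sum>k=1..N. inner (e k) v * inner (e j) (e k))"
    by (simp add: P_def inner_sum_right)
  also have "\<dots> = (\<Sum>k=1..N. if k = j then inner (e k) v else 0)"
    using assms by (intro sum.cong refl) (auto simp: inner_e_e)
  also have "\<dots> = (if j \<le> N then inner (e j) v else 0)"
    using assms by auto
  finally show ?thesis .
qed

lemma P_P: "P N (P N v) = P N v"
  by (rule L2_eqI_sine_coefficients) (simp add: inner_e_P)

text \<open>
  All coefficients beyond the \<open>N\<close>-th vanish, so the defining series is a finite sum.
\<close>

lemma frac_pow_P:
  "frac_pow \<nu> r (P N v) = (\<Sum>k=1..N. (eigenval \<nu> k powr r * inner (e k) v) *\<^sub>R e k)"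
proof -
  have "frac_pow \<nu> r (P N v)
      = (\<Sum>n<N. (eigenval \<nu> (Suc n) powr r * inner (e (Suc n)) (P N v)) *\<^sub>R e (Suc n))"
    unfolding frac_pow_def by (rule suminf_finite) (auto simp: inner_e_P)
  also have "\<dots> = (\<Sum>n<N. (eigenval \<nu> (Suc n) powr r * inner (e (Suc n)) v) *\<^sub>R e (Suc n))"
    by (intro sum.cong refl) (simp add: inner_e_P)
  finally show ?thesis
    by (simp add: sum.atLeast1_atMost_eq)
qed

lemma inner_sum_e_sum_e:
  "inner (\<Sum>k=1..N. a k *\<^sub>R e k) (\<Sum>k=1..N. b k *\<^sub>R e k) = (\<Sum>k=1..N. a k * b k)"
proof -
  have "inner (\<Sum>k=1..N. a k *\<^sub>R e k) (\<Sum>k=1..N. b k *\<^sub>R e k)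
      = (\<Sum>j=1..N. \<Sum>k=1..N. a j * (b k * inner (e j) (e k)))"
    unfolding inner_sum_left unfolding inner_sum_right by (simp add: mult.left_commute)
  also have "\<dots> = (\<Sum>j=1..N. \<Sum>k=1..N. if k = j then a j * b j else 0)"
    by (intro sum.cong refl) (auto simp: inner_e_e)
  also have "\<dots> = (\<Sum>k=1..N. a k * b k)"
    by (intro sum.cong refl) simp
  finally show ?thesis .
qed

text \<open>
  One of the two half powers is moved to the other argument. The resulting full power of
  \<open>v\<close> stays in the range of \<open>P N\<close>, where testing against
  \<open>P N f\<close> and against \<open>f\<close> is the same.
\<close>

lemma H_inner_half_P:
  assumes v: "v \<in> range (P N)"
  shows "H_inner \<nu> (1/2) v (P N f) = inner (frac_pow \<nu> 1 v) f"
proof -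
  obtain u where u: "v = P N u" using v by blast
  have "H_inner \<nu> (1/2) v (P N f)
      = (\<Sum>k=1..N. eigenval \<nu> k powr (1/2) * inner (e k) u * (eigenval \<nu> k powr (1/2) * inner (e k) f))"
    unfolding H_inner_def u frac_pow_P by (rule inner_sum_e_sum_e)
  also have "\<dots> = (\<Sum>k=1..N. eigenval \<nu> k powr 1 * inner (e k) u * inner (e k) f)"
  proof (intro sum.cong refl)
    fix k assume "k \<in> {1..N}"
    have "eigenval \<nu> k powr 1 = eigenval \<nu> k powr (1/2) * eigenval \<nu> k powr (1/2)"
      by (simp flip: powr_add)
    then show "eigenval \<nu> k powr (1/2) * inner (e k) u * (eigenval \<nu> k powr (1/2) * inner (e k) f)
        = eigenval \<nu> k powr 1 * inner (e k) u * inner (e k) f"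
      by (simp only: mult_ac)
  qed
  also have "\<dots> = inner (frac_pow \<nu> 1 v) f"
    by (simp add: u frac_pow_P inner_sum_left)
  finally show ?thesis .
qed

lemma sum_e_eq_abs_L2:
  assumes "finite K"
  shows "(\<Sum>k\<in>K. b k *\<^sub>R e k) = abs_L2 (\<lambda>x. \<Sum>k\<in>K. b k * e_fun k x)"
  using assms
proof (induction K)
  case empty
  show ?case by (simp add: zero_L2_def)
next
  case (insert k K)
  have "sq_integrable (\<lambda>x. \<Sum>k\<in>K. b k * e_fun k x)"
    by (intro sq_integrable_continuous continuous_intros continuous_on_e_fun)
  moreover have "b k *\<^sub>R e k = abs_L2 (\<lambda>x. b k * e_fun k x)"
    unfolding e_eq_abs_L2 by (rule scaleR_L2.abs_eq) (simp add: sq_integrable_e_fun)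
  ultimately show ?case
    using insert plus_L2.abs_eq[of "\<lambda>x. b k * e_fun k x" "\<lambda>x. \<Sum>k\<in>K. b k * e_fun k x"]
    by (simp add: sq_integrable_cmult sq_integrable_e_fun)
qed

text \<open>
  The fundamental theorem of calculus for \<open>V' p(V)\<close>: the boundary terms vanish since
  \<open>V\<close> is zero at both ends and \<open>p\<close> is zero at zero.
\<close>

lemma LINT_Dirichlet_Laplacian_by_parts:
  fixes p p' :: "real \<Rightarrow> real"
  assumes V: "\<And>x. (V has_real_derivative V' x) (at x)"
    and V': "\<And>x. (V' has_real_derivative V'' x) (at x)"
    and c: "continuous_on UNIV V''" and bc: "V 0 = 0" "V 1 = 0"
    and p: "\<And>y. (p has_real_derivative p' y) (at y)" and p': "continuous_on UNIV p'" and "p 0 = 0"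
  shows "(LINT x|M01. - V'' x * p (V x)) = (LINT x|M01. (V' x)\<^sup>2 * p' (V x))"
proof -
  have cV: "continuous_on {0..1} V" and cV': "continuous_on {0..1} V'"
    using V V' by (meson DERIV_continuous_on has_field_derivative_at_within)+
  have cV'': "continuous_on {0..1} V''" using c continuous_on_subset by blast
  have "continuous_on UNIV p" using p by (meson DERIV_continuous_on)
  note cp = continuous_on_compose2[OF this cV subset_UNIV] continuous_on_compose2[OF p' cV subset_UNIV]
  have "(LINT x|M01. (V' x)\<^sup>2 * p' (V x) - - V'' x * p (V x)) = V' 1 * p (V 1) - V' 0 * p (V 0)"
  proof (rule LINT_M01_derivative)
    show "continuous_on {0..1} (\<lambda>x. (V' x)\<^sup>2 * p' (V x) - - V'' x * p (V x))"
      by (intro continuous_intros cV' cV'' cp)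
    fix x :: real
    have "((\<lambda>x. V' x * p (V x)) has_real_derivative V' x * (p' (V x) * V' x) + V'' x * p (V x)) (at x)"
      by (intro DERIV_mult' V' DERIV_chain2[OF p V])
    then show "((\<lambda>x. V' x * p (V x)) has_real_derivative (V' x)\<^sup>2 * p' (V x) - - V'' x * p (V x)) (at x within {0..1})"
      by (rule has_field_derivative_at_within[THEN DERIV_cong]) (simp add: power2_eq_square mult_ac)
  qed
  moreover have "integrable M01 (\<lambda>x. (V' x)\<^sup>2 * p' (V x))" "integrable M01 (\<lambda>x. - V'' x * p (V x))"
    by (intro integrable_sq_integrable sq_integrable_continuous continuous_intros cV' cV'' cp)+
  ultimately show ?thesis
    using bc \<open>p 0 = 0\<close> by simp
qed

text \<open>
  Here \<open>V\<close> is the trigonometric polynomial representing \<open>v\<close>, and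
  \<open>Z = -\<nu> V''\<close>. Two integrations by parts, one for \<open>p\<close> and one for the
  identity, compare the integrals of \<open>Z p(V)\<close> and of \<open>Z V\<close> through the
  common weight \<open>\<nu> (V')\<^sup>2\<close>; the latter integral is the squared
  \<open>H\<^sub>1\<^sub>/\<^sub>2\<close>-norm of \<open>v\<close>.
\<close>

lemma P_range_representative:
  assumes \<nu>: "0 < \<nu>" and v: "v \<in> range (P N)"
  obtains V Z where "continuous_on {0..1} V" "continuous_on {0..1} Z"
    "v = abs_L2 V" "frac_pow \<nu> 1 v = abs_L2 Z"
    "\<And>p p' B. (\<And>y. (p has_real_derivative p' y) (at y)) \<Longrightarrow> continuous_on UNIV p' \<Longrightarrow> p 0 = 0 \<Longrightarrow>
      (\<And>y. p' y \<le> B) \<Longrightarrow> (LINT x|M01. Z x * p (V x)) \<le> B * (LINT x|M01. Z x * V x)"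
proof -
  obtain u where u: "v = P N u" using v by blast
  define b where "b k = inner (e k) u" for k
  define V where "V x = (\<Sum>k=1..N. b k * e_fun k x)" for x
  define V' where "V' x = (\<Sum>k=1..N. b k * (sqrt 2 * (real k * pi) * cos (real k * pi * x)))" for x
  define Z where "Z x = (\<Sum>k=1..N. (eigenval \<nu> k * b k) * e_fun k x)" for x
  have V: "(V has_real_derivative V' x) (at x)" for x
    unfolding V_def V'_def e_fun_def by (auto intro!: derivative_eq_intros sum.cong)
  have "(V' has_real_derivative (\<Sum>k=1..N. b k * (- (real k * pi)\<^sup>2 * e_fun k x))) (at x)" for x
    unfolding V'_def e_fun_def by (auto intro!: derivative_eq_intros sum.cong simp: power2_eq_square)
  moreover have "(\<Sum>k=1..N. b k * (- (real k * pi)\<^sup>2 * e_fun k x)) = - Z x / \<nu>" for x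
    unfolding Z_def sum_divide_distrib sum_negf[symmetric]
    using \<nu> by (intro sum.cong refl) (simp add: eigenval_eq)
  ultimately have V': "(V' has_real_derivative - Z x / \<nu>) (at x)" for x
    by simp
  have bc: "V 0 = 0" "V 1 = 0"
    by (simp_all add: V_def e_fun_def)
  have cZ: "continuous_on S Z" for S
    unfolding Z_def by (intro continuous_intros continuous_on_e_fun)
  have cV: "continuous_on S V" for S
    unfolding V_def by (intro continuous_intros continuous_on_e_fun)
  have cV': "continuous_on S V'" for S
    unfolding V'_def by (intro continuous_intros)
  have parts: "(LINT x|M01. Z x * p (V x)) = \<nu> * (LINT x|M01. (V' x)\<^sup>2 * p' (V x))"
    if p: "\<And>y. (p has_real_derivative p' y) (at y)" "continuous_on UNIV p'" "p 0 = 0" for p p'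
  proof -
    have "continuous_on UNIV (\<lambda>x. - Z x / \<nu>)"
      using \<nu> by (intro continuous_intros cZ) auto
    from LINT_Dirichlet_Laplacian_by_parts[OF V V' this bc p]
    have "(LINT x|M01. Z x * p (V x) / \<nu>) = (LINT x|M01. (V' x)\<^sup>2 * p' (V x))"
      by simp
    then show ?thesis using \<nu> by (simp add: field_simps)
  qed
  show ?thesis
  proof (rule that)
    show "continuous_on {0..1} V" "continuous_on {0..1} Z" by (rule cV, rule cZ)
    show "v = abs_L2 V"
      unfolding u P_def V_def b_def by (rule sum_e_eq_abs_L2) simp
    have "frac_pow \<nu> 1 v = (\<Sum>k=1..N. (eigenval \<nu> k * b k) *\<^sub>R e k)"
      unfolding u frac_pow_P b_def using \<nu>
      by (intro sum.cong refl) (simp add: less_imp_le[OF eigenval_pos])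
    then show "frac_pow \<nu> 1 v = abs_L2 Z"
      unfolding Z_def by (simp add: sum_e_eq_abs_L2)
    fix p p' :: "real \<Rightarrow> real" and B
    assume p: "\<And>y. (p has_real_derivative p' y) (at y)" "continuous_on UNIV p'" "p 0 = 0"
      and B: "\<And>y. p' y \<le> B"
    have "(LINT x|M01. (V' x)\<^sup>2 * p' (V x)) \<le> (LINT x|M01. B * ((V' x)\<^sup>2 * 1))"
    proof (rule integral_mono)
      show "integrable M01 (\<lambda>x. (V' x)\<^sup>2 * p' (V x))" "integrable M01 (\<lambda>x. B * ((V' x)\<^sup>2 * 1))"
        by (intro integrable_sq_integrable sq_integrable_continuous continuous_intros cV'
          continuous_on_compose2[OF p(2) cV subset_UNIV])+
      show "(V' x)\<^sup>2 * p' (V x) \<le> B * ((V' x)\<^sup>2 * 1)" for x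
        using mult_left_mono[OF B[of "V x"] zero_le_power2[of "V' x"]] by (simp add: mult.commute)
    qed
    also have "\<dots> = B * (LINT x|M01. (V' x)\<^sup>2 * 1)" by simp
    finally have "\<nu> * (LINT x|M01. (V' x)\<^sup>2 * p' (V x)) \<le> B * (\<nu> * (LINT x|M01. (V' x)\<^sup>2 * 1))"
      using \<nu> by (simp add: mult.left_commute[of B])
    moreover have "(LINT x|M01. Z x * V x) = \<nu> * (LINT x|M01. (V' x)\<^sup>2 * 1)"
      by (rule parts) (auto intro!: derivative_eq_intros continuous_intros)
    ultimately show "(LINT x|M01. Z x * p (V x)) \<le> B * (LINT x|M01. Z x * V x)"
      by (simp add: parts[OF p])
  qed
qed


section \<open>Pointwise polynomial inequalities\<close>

text \<open>
  Completing the square: for \<open>a\<^sub>3 < 0\<close> the concave parabola has its maximum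
  \<open>a\<^sub>1 + a\<^sub>2\<^sup>2 / (3 |a\<^sub>3|)\<close>. For \<open>a\<^sub>3 = 0\<close>
  it is constant and the indicator only prevents a division by zero.
\<close>

lemma cubic_derivative_upper_bound:
  fixes a1 a2 a3 y :: real
  assumes "a3 \<le> 0" "a3 = 0 \<Longrightarrow> a2 = 0"
  shows "a1 + 2 * a2 * y + 3 * a3 * y\<^sup>2 \<le> \<bar>a1\<bar> + \<bar>a2\<bar>\<^sup>2 / (3 * \<bar>a3\<bar> + indicator {0} a3)"
proof (cases "a3 = 0")
  case True
  then show ?thesis using assms by simp
next
  case False
  define b where "b = - a3"
  have b: "0 < b" "a3 = - b" using assms False by (auto simp: b_def)
  have "0 \<le> (3 * b * y - a2)\<^sup>2 / (3 * b)" using b by simp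
  also have "\<dots> = 3 * b * y\<^sup>2 - 2 * a2 * y + a2\<^sup>2 / (3 * b)"
    using b by (simp add: field_simps power2_eq_square)
  finally show ?thesis
    using b by (simp add: indicator_def)
qed

text \<open>
  With \<open>m = max 1 |w|\<close> the left side is at most
  \<open>|v|\<^sup>i m\<^sup>4\<^sup>-\<^sup>i\<close>, homogeneous of degree four. If
  \<open>m \<le> \<delta> |v|\<close>, at least one factor \<open>m\<close> yields the small factor
  \<open>\<delta>\<close>; otherwise \<open>|v| < m / \<delta>\<close> and everything is bounded by
  a multiple of \<open>m\<^sup>4\<close>.
\<close>

lemma Young_monomial:
  fixes v w \<delta> :: real
  assumes \<delta>: "0 < \<delta>" "\<delta> \<le> 1" and ij: "i \<le> 3" "i + j \<le> 4"
  shows "\<bar>v\<bar> ^ i * \<bar>w\<bar> ^ j \<le> \<delta> * v ^ 4 + (1 + w ^ 4) / \<delta> ^ 3"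
proof -
  define m where "m = max 1 \<bar>w\<bar>"
  have m: "1 \<le> m" "\<bar>w\<bar> \<le> m" by (auto simp: m_def)
  have m4: "m ^ 4 \<le> 1 + w ^ 4"
    by (auto simp: m_def max_def)
  have "\<bar>w\<bar> ^ j \<le> m ^ j" using m by (intro power_mono) auto
  also have "\<dots> \<le> m ^ (4 - i)" using m ij by (intro power_increasing) auto
  finally have "\<bar>v\<bar> ^ i * \<bar>w\<bar> ^ j \<le> \<bar>v\<bar> ^ i * m ^ (4 - i)"
    by (intro mult_left_mono) auto
  also have "\<dots> \<le> \<delta> * v ^ 4 + (1 + w ^ 4) / \<delta> ^ 3"
  proof (cases "m \<le> \<delta> * \<bar>v\<bar>")
    case True
    have "m ^ (4 - i) \<le> (\<delta> * \<bar>v\<bar>) ^ (4 - i)"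
      using True m by (intro power_mono) auto
    also have "\<dots> = \<delta> ^ (4 - i) * \<bar>v\<bar> ^ (4 - i)" by (rule power_mult_distrib)
    also have "\<dots> \<le> \<delta> ^ 1 * \<bar>v\<bar> ^ (4 - i)"
      using \<delta> ij by (intro mult_right_mono power_decreasing) auto
    finally have "\<bar>v\<bar> ^ i * m ^ (4 - i) \<le> \<bar>v\<bar> ^ i * (\<delta> * \<bar>v\<bar> ^ (4 - i))"
      by (intro mult_left_mono) auto
    also have "\<dots> = \<delta> * v ^ 4"
      using ij by (simp add: mult.left_commute flip: power_add)
    also have "\<dots> \<le> \<delta> * v ^ 4 + (1 + w ^ 4) / \<delta> ^ 3"
      using \<delta> by (simp add: add_nonneg_nonneg)
    finally show ?thesis .
  next
    case False
    then have "\<bar>v\<bar> \<le> m / \<delta>" using \<delta> by (simp add: field_simps)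
    then have "\<bar>v\<bar> ^ i \<le> (m / \<delta>) ^ i" by (intro power_mono) auto
    then have "\<bar>v\<bar> ^ i * m ^ (4 - i) \<le> (m / \<delta>) ^ i * m ^ (4 - i)"
      using m by (intro mult_right_mono) auto
    also have "\<dots> = m ^ 4 / \<delta> ^ i"
      using ij by (simp add: power_divide flip: power_add)
    also have "\<dots> \<le> m ^ 4 / \<delta> ^ 3"
      using \<delta> ij m by (intro divide_left_mono power_decreasing) auto
    also have "\<dots> \<le> (1 + w ^ 4) / \<delta> ^ 3"
      using m4 \<delta> by (intro divide_right_mono) auto
    also have "\<dots> \<le> \<delta> * v ^ 4 + (1 + w ^ 4) / \<delta> ^ 3"
      using \<delta> by simp
    finally show ?thesis .
  qed
  finally show ?thesis .
qed

text \<open>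
  Serves to choose the parameter of Young's inequality uniformly in the cases
  \<open>a\<^sub>3 < 0\<close> and \<open>a\<^sub>3 = 0\<close>; in the latter there is no
  dissipation, but also nothing to absorb.
\<close>

lemma small_factor_exists:
  fixes A B :: real
  assumes "0 \<le> A" "0 \<le> B" "B = 0 \<Longrightarrow> A = 0"
  obtains \<delta> where "0 < \<delta>" "\<delta> \<le> 1" "A * \<delta> \<le> B"
proof (cases "B = 0")
  case True
  with assms that[of 1] show ?thesis by simp
next
  case False
  with assms have "0 < B" by simp
  have "A * (B / (A + B)) \<le> B"
    using assms \<open>0 < B\<close> by (simp add: field_simps)
  with that[of "B / (A + B)"] assms \<open>0 < B\<close> show ?thesis by (simp add: field_simps)
qed

text \<open>
  After expansion all terms except those of \<open>a\<^sub>0\<close>, \<open>a\<^sub>1\<close> and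
  \<open>a\<^sub>3 v\<^sup>4\<close> are monomials of degree at most three in \<open>v\<close> and
  at most four in total. Young's inequality bounds them by a small multiple of
  \<open>v\<^sup>4\<close> and a multiple of \<open>1 + w\<^sup>4\<close>, which costs half of the
  dissipation. The factor \<open>3 / 2\<close> of \<open>|a\<^sub>1|\<close> is \<open>1\<close>
  from \<open>a\<^sub>1 v\<^sup>2\<close> and \<open>1 / 2\<close> from
  \<open>a\<^sub>1 v w\<close>.
\<close>

lemma cubic_dissipative:
  fixes a0 a1 a2 a3 :: real
  assumes "a3 \<le> 0" "a3 = 0 \<Longrightarrow> a2 = 0"
  obtains D where "0 \<le> D"
    "\<And>v w. v * (a0 + a1 * (v + w) + a2 * (v + w)\<^sup>2 + a3 * (v + w) ^ 3)
      \<le> - (\<bar>a3\<bar> / 2) * v ^ 4 + (\<bar>a0\<bar> + 3 * \<bar>a1\<bar> / 2) * v\<^sup>2 + D * (1 + w ^ 4)"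
proof -
  \<comment> \<open>The sum of the absolute values of the coefficients of these monomials.\<close>
  define k where "k = 4 * \<bar>a2\<bar> + 7 * \<bar>a3\<bar>"
  obtain \<delta> where \<delta>: "0 < \<delta>" "\<delta> \<le> 1" and k\<delta>: "k * \<delta> \<le> \<bar>a3\<bar> / 2"
  proof (rule small_factor_exists[of k "\<bar>a3\<bar> / 2"])
    show "k = 0" if "\<bar>a3\<bar> / 2 = 0" using that assms by (simp add: k_def)
  qed (simp_all add: k_def)
  define D where "D = k / \<delta> ^ 3 + \<bar>a0\<bar> + \<bar>a1\<bar>"
  have k0: "0 \<le> k" by (simp add: k_def)
  have "0 \<le> D" using \<delta> k0 by (simp add: D_def)
  moreover have "v * (a0 + a1 * (v + w) + a2 * (v + w)\<^sup>2 + a3 * (v + w) ^ 3)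
      \<le> - (\<bar>a3\<bar> / 2) * v ^ 4 + (\<bar>a0\<bar> + 3 * \<bar>a1\<bar> / 2) * v\<^sup>2 + D * (1 + w ^ 4)" for v w
  proof -
    define Y where "Y = \<delta> * v ^ 4 + (1 + w ^ 4) / \<delta> ^ 3"
    have mono: "r * (v ^ i * w ^ j) \<le> \<bar>r\<bar> * Y" if "i \<le> 3" "i + j \<le> 4" for r i j
    proof -
      have "r * (v ^ i * w ^ j) \<le> \<bar>r\<bar> * (\<bar>v\<bar> ^ i * \<bar>w\<bar> ^ j)"
        by (rule order_trans[OF abs_ge_self]) (simp add: abs_mult power_abs)
      also have "\<dots> \<le> \<bar>r\<bar> * Y"
        unfolding Y_def using Young_monomial[OF \<delta> that] by (intro mult_left_mono) auto
      finally show ?thesis .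
    qed
    have "v * (a0 + a1 * (v + w) + a2 * (v + w)\<^sup>2 + a3 * (v + w) ^ 3)
      = a0 * v + a1 * v\<^sup>2 + a1 * (v * w) + a3 * v ^ 4
        + (a2 * (v ^ 3 * w ^ 0) + (2 * a2) * (v ^ 2 * w ^ 1) + a2 * (v ^ 1 * w ^ 2)
        + (3 * a3) * (v ^ 3 * w ^ 1) + (3 * a3) * (v ^ 2 * w ^ 2) + a3 * (v ^ 1 * w ^ 3))"
      by (simp add: algebra_simps power2_eq_square power3_eq_cube power4_eq_xxxx)
    also have "\<dots> \<le> a0 * v + a1 * v\<^sup>2 + a1 * (v * w) + a3 * v ^ 4 + k * Y"
      using mono[of 3 0 a2] mono[of 2 1 "2 * a2"] mono[of 1 2 a2]
        mono[of 3 1 "3 * a3"] mono[of 2 2 "3 * a3"] mono[of 1 3 a3]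
      by (simp add: k_def abs_mult algebra_simps)
    also have "k * Y = (k * \<delta>) * v ^ 4 + k / \<delta> ^ 3 * (1 + w ^ 4)"
      by (simp add: Y_def algebra_simps add_divide_distrib)
    also have "(k * \<delta>) * v ^ 4 \<le> \<bar>a3\<bar> / 2 * v ^ 4"
      using k\<delta> by (intro mult_right_mono) auto
    also have "a0 * v \<le> \<bar>a0\<bar> * (v\<^sup>2 + 1)"
    proof -
      have v1: "\<bar>v\<bar> \<le> v\<^sup>2 + 1"
        using zero_le_power2[of "\<bar>v\<bar> - 1"] by (simp add: power2_diff)
      have ax: "\<bar>a0\<bar> * \<bar>v\<bar> \<le> \<bar>a0\<bar> * (v\<^sup>2 + 1)"
        using v1 by (intro mult_left_mono) auto
      show ?thesis
        by (rule order_trans[OF abs_ge_self]) (use ax in \<open>simp only: abs_mult[of a0]\<close>)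
    qed
    also have "a1 * v\<^sup>2 \<le> \<bar>a1\<bar> * v\<^sup>2"
      by (intro mult_right_mono) auto
    also have "a1 * (v * w) \<le> \<bar>a1\<bar> * (v\<^sup>2 / 2 + (1 + w ^ 4) / 2)"
    proof -
      have vw: "\<bar>v * w\<bar> \<le> v\<^sup>2 / 2 + w\<^sup>2 / 2"
        using zero_le_power2[of "\<bar>v\<bar> - \<bar>w\<bar>"] by (simp add: power2_diff abs_mult)
      have w2: "w\<^sup>2 \<le> 1 + w ^ 4"
      proof -
        have "2 * w\<^sup>2 \<le> w ^ 4 + 1"
          using zero_le_power2[of "w\<^sup>2 - 1"] by (simp add: power2_diff)
        moreover have "0 \<le> w ^ 4" by simp
        ultimately show ?thesis by linarith
      qed
      have vw4: "\<bar>v * w\<bar> \<le> v\<^sup>2 / 2 + (1 + w ^ 4) / 2"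
        by (rule order_trans[OF vw]) (use w2 in simp)
      have ax: "\<bar>a1\<bar> * \<bar>v * w\<bar> \<le> \<bar>a1\<bar> * (v\<^sup>2 / 2 + (1 + w ^ 4) / 2)"
        using vw4 by (intro mult_left_mono) auto
      show ?thesis
        by (rule order_trans[OF abs_ge_self]) (use ax in \<open>simp only: abs_mult[of a1]\<close>)
    qed
    finally have "v * (a0 + a1 * (v + w) + a2 * (v + w)\<^sup>2 + a3 * (v + w) ^ 3)
      \<le> \<bar>a0\<bar> * (v\<^sup>2 + 1) + \<bar>a1\<bar> * v\<^sup>2 + \<bar>a1\<bar> * (v\<^sup>2 / 2 + (1 + w ^ 4) / 2) + a3 * v ^ 4
        + (\<bar>a3\<bar> / 2 * v ^ 4 + k / \<delta> ^ 3 * (1 + w ^ 4))" by simp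
    moreover define X where "X = 1 + w ^ 4"
    moreover have "\<bar>a0\<bar> * 1 \<le> \<bar>a0\<bar> * X" "\<bar>a1\<bar> * (X / 2) \<le> \<bar>a1\<bar> * X"
      by (intro mult_left_mono; simp add: X_def)+
    ultimately show ?thesis
      unfolding D_def X_def[symmetric] using abs_of_nonpos[OF assms(1)] by (simp add: algebra_simps)
  qed
  ultimately show ?thesis by (rule that)
qed

lemma square_of_sum6:
  fixes x1 x2 x3 x4 x5 x6 :: real
  shows "(x1 + x2 + x3 + x4 + x5 + x6)\<^sup>2 \<le> 6 * (x1\<^sup>2 + x2\<^sup>2 + x3\<^sup>2 + x4\<^sup>2 + x5\<^sup>2 + x6\<^sup>2)"
proof -
  have two: "(x + y)\<^sup>2 \<le> 2 * x\<^sup>2 + 2 * y\<^sup>2" for x y :: real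
    using zero_le_power2[of "x - y"] by (simp add: power2_diff power2_sum)
  have three: "(x + y + z)\<^sup>2 \<le> 3 * x\<^sup>2 + 3 * y\<^sup>2 + 3 * z\<^sup>2" for x y z :: real
    using zero_le_power2[of "x - y"] zero_le_power2[of "x - z"] zero_le_power2[of "y - z"]
    by (simp add: power2_eq_square algebra_simps)
  show ?thesis
    using two[of "x1 + x2 + x3" "x4 + x5 + x6"] three[of x1 x2 x3] three[of x4 x5 x6]
    by (simp add: add.assoc)
qed

text \<open>
  The base of the square is \<open>F(v + w)\<close> minus
  \<open>a\<^sub>1 v + a\<^sub>2 v\<^sup>2 + a\<^sub>3 v\<^sup>3\<close>. Only
  \<open>3 a\<^sub>3 v\<^sup>2 w\<close> produces a term of degree four in \<open>v\<close> in the
  square, and it contributes \<open>2 * 9 a\<^sub>3\<^sup>2 K v\<^sup>4\<close> since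
  \<open>w\<^sup>2 \<le> K\<close>. The remaining \<open>46\<close> of the \<open>64\<close> are
  filled by terms with an adjustable small factor.
\<close>

lemma remainder_square_bound:
  fixes a0 a1 a2 a3 :: real
  assumes "a3 = 0 \<Longrightarrow> a2 = 0"
  obtains D where "0 \<le> D"
    "\<And>v w K. 1 + w ^ 4 \<le> K \<Longrightarrow>
      (a0 + a1 * w + a2 * (2 * v * w + w\<^sup>2) + a3 * (3 * v\<^sup>2 * w + 3 * v * w\<^sup>2 + w ^ 3))\<^sup>2
        \<le> 64 * a3\<^sup>2 * K * v ^ 4 + D * K\<^sup>2"
proof -
  \<comment> \<open>\<open>12 = 6 * 2\<close>: six for a sum of six terms squared, two for splitting off the leading term.\<close>
  define k where "k = 12 * (4 * a2\<^sup>2 + 9 * a3\<^sup>2)"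
  obtain \<delta> where \<delta>: "0 < \<delta>" "\<delta> \<le> 1" and k\<delta>: "k * \<delta> \<le> 46 * a3\<^sup>2"
  proof (rule small_factor_exists[of k "46 * a3\<^sup>2"])
    show "k = 0" if "46 * a3\<^sup>2 = 0" using that assms by (simp add: k_def)
  qed (simp_all add: k_def)
  define D where "D = k / \<delta> ^ 3 + 12 * (a0\<^sup>2 + a1\<^sup>2 + a2\<^sup>2 + a3\<^sup>2)"
  have k0: "0 \<le> k" by (simp add: k_def)
  have "0 \<le> D" using \<delta> k0 by (simp add: D_def)
  moreover have "(a0 + a1 * w + a2 * (2 * v * w + w\<^sup>2) + a3 * (3 * v\<^sup>2 * w + 3 * v * w\<^sup>2 + w ^ 3))\<^sup>2
        \<le> 64 * a3\<^sup>2 * K * v ^ 4 + D * K\<^sup>2" if K: "1 + w ^ 4 \<le> K" for v w K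
  proof -
    have "0 \<le> w ^ 4" by simp
    then have K1: "1 \<le> K" using K by linarith
    have w2: "w\<^sup>2 \<le> K"
      using zero_le_power2[of "w\<^sup>2 - 1"] K K1 by (simp add: power2_diff)
    have w4: "w ^ 4 \<le> K" using K by simp
    have KK: "K \<le> K\<^sup>2" using K1 by (simp add: power2_eq_square)
    define Q where "Q = a0 + a1 * w + 2 * a2 * (v * w) + a2 * w\<^sup>2 + 3 * a3 * (v * w\<^sup>2) + a3 * w ^ 3"
    define Y where "Y = \<delta> * v ^ 4 + K / \<delta> ^ 3"
    have vw: "v\<^sup>2 * w\<^sup>2 \<le> Y"
    proof -
      have "v\<^sup>2 * w\<^sup>2 \<le> \<delta> * v ^ 4 + (1 + w ^ 4) / \<delta> ^ 3"
        using Young_monomial[OF \<delta>, of 2 2 v w] by simp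
      also have "\<dots> \<le> Y"
        unfolding Y_def using K \<delta> by (intro add_left_mono divide_right_mono) auto
      finally show ?thesis .
    qed
    have Y0: "0 \<le> Y" using vw by (smt (verit) mult_nonneg_nonneg zero_le_power2)
    have YKY: "Y \<le> K * Y" using K1 Y0 mult_right_mono[of 1 K Y] by simp
    have b1: "w\<^sup>2 \<le> K\<^sup>2" and b2: "w ^ 4 \<le> K\<^sup>2" and b0: "1 \<le> K\<^sup>2" using w2 w4 KK K1 by linarith+
    have b6: "w ^ 6 \<le> K\<^sup>2"
    proof -
      have "w ^ 6 = w\<^sup>2 * w ^ 4" by (simp flip: power_add)
      also have "\<dots> \<le> K * K" using w2 w4 K1 by (intro mult_mono) auto
      finally show ?thesis by (simp add: power2_eq_square)
    qed
    have b3: "v\<^sup>2 * w\<^sup>2 \<le> K * Y" using vw YKY by simp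
    have b4: "v\<^sup>2 * w ^ 4 \<le> K * Y"
    proof -
      have "v\<^sup>2 * w ^ 4 = w\<^sup>2 * (v\<^sup>2 * w\<^sup>2)" by (simp add: power4_eq_xxxx power2_eq_square)
      also have "\<dots> \<le> K * Y" using w2 vw K1 by (intro mult_mono) auto
      finally show ?thesis .
    qed
    have "Q\<^sup>2 \<le> 6 * (a0\<^sup>2 + (a1 * w)\<^sup>2 + (2 * a2 * (v * w))\<^sup>2 + (a2 * w\<^sup>2)\<^sup>2 + (3 * a3 * (v * w\<^sup>2))\<^sup>2 + (a3 * w ^ 3)\<^sup>2)"
      unfolding Q_def by (rule square_of_sum6)
    also have "\<dots> = 6 * (a0\<^sup>2 * 1 + a1\<^sup>2 * w\<^sup>2 + (4 * a2\<^sup>2) * (v\<^sup>2 * w\<^sup>2) + a2\<^sup>2 * w ^ 4 + (9 * a3\<^sup>2) * (v\<^sup>2 * w ^ 4) + a3\<^sup>2 * w ^ 6)"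
      by (simp add: power_mult_distrib flip: power_mult)
    also have "\<dots> \<le> 6 * (a0\<^sup>2 * K\<^sup>2 + a1\<^sup>2 * K\<^sup>2 + (4 * a2\<^sup>2) * (K * Y) + a2\<^sup>2 * K\<^sup>2 + (9 * a3\<^sup>2) * (K * Y) + a3\<^sup>2 * K\<^sup>2)"
      by (intro mult_left_mono add_mono b0 b1 b2 b3 b4 b6) auto
    also have "2 * \<dots> = k * \<delta> * (K * v ^ 4) + D * K\<^sup>2"
      by (simp add: D_def k_def Y_def algebra_simps power2_eq_square add_divide_distrib)
    also have "k * \<delta> * (K * v ^ 4) \<le> 46 * a3\<^sup>2 * (K * v ^ 4)"
      using k\<delta> K1 by (intro mult_right_mono) auto
    finally have Q: "2 * Q\<^sup>2 \<le> 46 * a3\<^sup>2 * (K * v ^ 4) + D * K\<^sup>2" by simp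
    have "(a0 + a1 * w + a2 * (2 * v * w + w\<^sup>2) + a3 * (3 * v\<^sup>2 * w + 3 * v * w\<^sup>2 + w ^ 3)) = 3 * a3 * v\<^sup>2 * w + Q"
      by (simp add: Q_def algebra_simps)
    then have "(a0 + a1 * w + a2 * (2 * v * w + w\<^sup>2) + a3 * (3 * v\<^sup>2 * w + 3 * v * w\<^sup>2 + w ^ 3))\<^sup>2
        \<le> 2 * (3 * a3 * v\<^sup>2 * w)\<^sup>2 + 2 * Q\<^sup>2"
      using zero_le_power2[of "3 * a3 * v\<^sup>2 * w - Q"] by (simp add: power2_sum power2_diff)
    also have "2 * (3 * a3 * v\<^sup>2 * w)\<^sup>2 = 18 * a3\<^sup>2 * v ^ 4 * w\<^sup>2"
      by (simp add: power_mult_distrib flip: power_mult)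
    also have "\<dots> \<le> 18 * a3\<^sup>2 * v ^ 4 * K"
      using w2 by (intro mult_left_mono) auto
    finally show ?thesis using Q by (simp add: algebra_simps)
  qed
  ultimately show ?thesis by (rule that)
qed

text \<open>
  The number \<open>64\<close> of the preceding bound meets \<open>1 / (4 \<epsilon>)\<close> from
  Young's inequality for \<open>z\<close> times the remainder:
  \<open>16 a\<^sub>3\<^sup>2 / \<epsilon>\<close> is at most \<open>c |a\<^sub>3| / 2\<close>, the
  dissipation still available after bounding \<open>v F(v + w)\<close>.
\<close>

lemma pointwise_estimate:
  fixes \<epsilon> c a0 a1 a2 a3 :: real
  assumes "a3 \<le> 0" "a3 = 0 \<Longrightarrow> a2 = 0" "0 < \<epsilon>" and c: "32 / \<epsilon> * \<bar>a3\<bar> \<le> c"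
  obtains C where "0 < C"
    "\<And>v w z K. 1 + w ^ 4 \<le> K \<Longrightarrow>
      z * (a0 + a1 * (v + w) + a2 * (v + w)\<^sup>2 + a3 * (v + w) ^ 3)
        + c * K * (v * (a0 + a1 * (v + w) + a2 * (v + w)\<^sup>2 + a3 * (v + w) ^ 3))
      \<le> \<epsilon> * z\<^sup>2 + z * (a1 * v + a2 * v\<^sup>2 + a3 * v ^ 3)
        + c * K * (\<bar>a0\<bar> + 3 * \<bar>a1\<bar> / 2) * v\<^sup>2 + C * K\<^sup>2"
proof -
  obtain D1 where D1: "0 \<le> D1" and diss: "\<And>v w. v * (a0 + a1 * (v + w) + a2 * (v + w)\<^sup>2 + a3 * (v + w) ^ 3)
      \<le> - (\<bar>a3\<bar> / 2) * v ^ 4 + (\<bar>a0\<bar> + 3 * \<bar>a1\<bar> / 2) * v\<^sup>2 + D1 * (1 + w ^ 4)"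
    using cubic_dissipative[OF assms(1,2)] by blast
  obtain D2 where D2: "0 \<le> D2" and rem: "\<And>v w K. 1 + w ^ 4 \<le> K \<Longrightarrow>
      (a0 + a1 * w + a2 * (2 * v * w + w\<^sup>2) + a3 * (3 * v\<^sup>2 * w + 3 * v * w\<^sup>2 + w ^ 3))\<^sup>2
        \<le> 64 * a3\<^sup>2 * K * v ^ 4 + D2 * K\<^sup>2"
    using remainder_square_bound[OF assms(2)] by blast
  have c0: "0 \<le> c" by (rule order_trans[OF _ c]) (use \<open>0 < \<epsilon>\<close> in simp)
  define C where "C = c * D1 + D2 / (4 * \<epsilon>) + 1"
  have "0 < C" using c0 D1 D2 \<open>0 < \<epsilon>\<close> by (simp add: C_def add_nonneg_pos)
  moreover have "z * (a0 + a1 * (v + w) + a2 * (v + w)\<^sup>2 + a3 * (v + w) ^ 3)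
        + c * K * (v * (a0 + a1 * (v + w) + a2 * (v + w)\<^sup>2 + a3 * (v + w) ^ 3))
      \<le> \<epsilon> * z\<^sup>2 + z * (a1 * v + a2 * v\<^sup>2 + a3 * v ^ 3)
        + c * K * (\<bar>a0\<bar> + 3 * \<bar>a1\<bar> / 2) * v\<^sup>2 + C * K\<^sup>2" if K: "1 + w ^ 4 \<le> K" for v w z K
  proof -
    have "0 \<le> w ^ 4" by simp
    then have K1: "1 \<le> K" using K by linarith
    define f where "f = a0 + a1 * (v + w) + a2 * (v + w)\<^sup>2 + a3 * (v + w) ^ 3"
    define R where "R = a0 + a1 * w + a2 * (2 * v * w + w\<^sup>2) + a3 * (3 * v\<^sup>2 * w + 3 * v * w\<^sup>2 + w ^ 3)"
    have f: "f = (a1 * v + a2 * v\<^sup>2 + a3 * v ^ 3) + R"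
      by (simp add: f_def R_def algebra_simps power2_eq_square power3_eq_cube)
    have "z * R \<le> \<epsilon> * z\<^sup>2 + R\<^sup>2 / (4 * \<epsilon>)"
    proof -
      have "0 \<le> (2 * \<epsilon> * z - R)\<^sup>2 / (4 * \<epsilon>)" using \<open>0 < \<epsilon>\<close> by simp
      also have "\<dots> = \<epsilon> * z\<^sup>2 + R\<^sup>2 / (4 * \<epsilon>) - z * R"
        using \<open>0 < \<epsilon>\<close> by (simp add: field_simps power2_eq_square)
      finally show ?thesis by simp
    qed
    also have "R\<^sup>2 / (4 * \<epsilon>) \<le> (64 * a3\<^sup>2 * K * v ^ 4 + D2 * K\<^sup>2) / (4 * \<epsilon>)"
      unfolding R_def using rem[OF K] \<open>0 < \<epsilon>\<close> by (intro divide_right_mono) auto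
    also have "\<dots> = (32 / \<epsilon> * \<bar>a3\<bar>) * (\<bar>a3\<bar> / 2 * (K * v ^ 4)) + D2 / (4 * \<epsilon>) * K\<^sup>2"
      using \<open>0 < \<epsilon>\<close> by (simp add: field_simps power2_eq_square)
    also have "(32 / \<epsilon> * \<bar>a3\<bar>) * (\<bar>a3\<bar> / 2 * (K * v ^ 4)) \<le> c * (\<bar>a3\<bar> / 2 * (K * v ^ 4))"
      using c K1 by (intro mult_right_mono) auto
    finally have 1: "z * R \<le> \<epsilon> * z\<^sup>2 + c * (\<bar>a3\<bar> / 2 * (K * v ^ 4)) + D2 / (4 * \<epsilon>) * K\<^sup>2"
      by simp
    have "v * f \<le> - (\<bar>a3\<bar> / 2) * v ^ 4 + (\<bar>a0\<bar> + 3 * \<bar>a1\<bar> / 2) * v\<^sup>2 + D1 * K"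
      using diss[of v w] mult_left_mono[OF K D1] unfolding f_def by simp
    then have "c * K * (v * f) \<le> c * K * (- (\<bar>a3\<bar> / 2) * v ^ 4 + (\<bar>a0\<bar> + 3 * \<bar>a1\<bar> / 2) * v\<^sup>2 + D1 * K)"
      using c0 K1 by (intro mult_left_mono) auto
    with 1 have "z * R + c * K * (v * f) \<le> \<epsilon> * z\<^sup>2 + c * K * (\<bar>a0\<bar> + 3 * \<bar>a1\<bar> / 2) * v\<^sup>2
        + (c * D1 + D2 / (4 * \<epsilon>)) * K\<^sup>2"
      by (simp add: algebra_simps power2_eq_square)
    moreover have "(c * D1 + D2 / (4 * \<epsilon>)) * K\<^sup>2 \<le> C * K\<^sup>2"
      by (intro mult_right_mono) (auto simp: C_def)
    moreover have "z * f = z * (a1 * v + a2 * v\<^sup>2 + a3 * v ^ 3) + z * R"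
      by (simp add: f distrib_left)
    ultimately show ?thesis unfolding f_def[symmetric] by linarith
  qed
  ultimately show ?thesis by (rule that)
qed

section \<open>The integrated estimate\<close>

lemma L6_I:
  assumes "AE x in M01. \<bar>rep_L2 v x\<bar> \<le> B"
  shows "v \<in> L6"
proof -
  have [measurable]: "rep_L2 v \<in> borel_measurable M01"
    by (rule sq_integrableD[OF sq_integrable_rep_L2])
  have "integrable M01 (\<lambda>x. rep_L2 v x ^ 6)"
  proof (rule M01.integrable_const_bound)
    show "AE x in M01. norm (rep_L2 v x ^ 6) \<le> B ^ 6"
      using assms
    proof eventually_elim
      case (elim x)
      then have "\<bar>rep_L2 v x\<bar> ^ 6 \<le> B ^ 6" by (intro power_mono) auto
      then show ?case by (simp add: power_abs)
    qed
  qed simp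
  then show ?thesis by (simp add: L6_def)
qed

theorem lemma6p1:
  fixes T \<nu> \<epsilon> c :: real and a :: "nat \<Rightarrow> real"
  assumes "0 < T" and "0 < \<nu>"
    and "a 3 \<le> 0"
    and "a 2 * indicator {0} (a 3) = 0"
    and "0 < \<epsilon>" and "\<epsilon> < 1"
    and "c \<ge> 32 / \<epsilon> * max (\<bar>a 2\<bar>\<^sup>2 / (\<bar>a 3\<bar> + indicator {0} (a 3))) \<bar>a 3\<bar>"
  shows "\<exists>C>0. \<forall>N\<ge>1. \<forall>v \<in> range (P N). \<forall>w \<in> C_space \<nu> T 1. \<forall>t\<in>{0..T}.
    H_inner \<nu> (1/2) v (P N (F a (v + w t)))
      + c * ((SUP s\<in>{0..T}. Linf_norm (w s) ^ 4) + 1) * inner v (F a (v + w t))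
    \<le> \<epsilon> * (H_norm \<nu> 1 v)\<^sup>2
      + (\<bar>a 1\<bar> + \<bar>a 2\<bar>\<^sup>2 / (3 * \<bar>a 3\<bar> + indicator {0} (a 3))) * (H_norm \<nu> (1/2) v)\<^sup>2
      + c * ((SUP s\<in>{0..T}. Linf_norm (w s) ^ 4) + 1) * (\<bar>a 0\<bar> + 3 * \<bar>a 1\<bar> / 2) * (norm v)\<^sup>2
      + C * ((SUP s\<in>{0..T}. Linf_norm (w s) ^ 8) + 1)"
proof -
  have a2: "a 2 = 0" if "a 3 = 0"
    using assms(4) that by simp
  have "32 / \<epsilon> * \<bar>a 3\<bar> \<le> 32 / \<epsilon> * max (\<bar>a 2\<bar>\<^sup>2 / (\<bar>a 3\<bar> + indicator {0} (a 3))) \<bar>a 3\<bar>"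
    using \<open>0 < \<epsilon>\<close> by (intro mult_left_mono) auto
  then have c: "32 / \<epsilon> * \<bar>a 3\<bar> \<le> c" using assms(7) by linarith
  obtain C where C: "0 < C" and pointwise: "\<And>v w z K. 1 + w ^ 4 \<le> K \<Longrightarrow>
      z * (a 0 + a 1 * (v + w) + a 2 * (v + w)\<^sup>2 + a 3 * (v + w) ^ 3)
        + c * K * (v * (a 0 + a 1 * (v + w) + a 2 * (v + w)\<^sup>2 + a 3 * (v + w) ^ 3))
      \<le> \<epsilon> * z\<^sup>2 + z * (a 1 * v + a 2 * v\<^sup>2 + a 3 * v ^ 3)
        + c * K * (\<bar>a 0\<bar> + 3 * \<bar>a 1\<bar> / 2) * v\<^sup>2 + C * K\<^sup>2"
    using pointwise_estimate[of "a 3" "a 2" \<epsilon> c "a 0" "a 1"] \<open>a 3 \<le> 0\<close> a2 \<open>0 < \<epsilon>\<close> c by blast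
  define B where "B = \<bar>a 1\<bar> + \<bar>a 2\<bar>\<^sup>2 / (3 * \<bar>a 3\<bar> + indicator {0} (a 3))"
  show ?thesis
  proof (intro exI[of _ "2 * C"] conjI allI impI ballI)
    show "0 < 2 * C" using C by simp
    fix N v w t
    assume v: "v \<in> range (P N)" and w: "w \<in> C_space \<nu> T 1" and t: "t \<in> {0..T}"
    define S4 where "S4 = (SUP s\<in>{0..T}. Linf_norm (w s) ^ 4)"
    define S8 where "S8 = (SUP s\<in>{0..T}. Linf_norm (w s) ^ 8)"
    define K where "K = S4 + 1"
    note S = C_space_SUP_Linf_norm[OF \<open>0 < \<nu>\<close> \<open>0 < T\<close> w t, folded S4_def S8_def]
    \<comment> \<open>Source of the factor two in the witness \<open>2 * C\<close>.\<close>
    have K2: "K\<^sup>2 \<le> 2 * (S8 + 1)"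
      using S(3) zero_le_power2[of "S4 - 1"] unfolding K_def by (simp add: power2_sum power2_diff)
    obtain V Z where cV: "continuous_on {0..1} V" and cZ: "continuous_on {0..1} Z"
      and vV: "v = abs_L2 V" and vZ: "frac_pow \<nu> 1 v = abs_L2 Z"
      and parts: "\<And>p p' B. (\<And>y. (p has_real_derivative p' y) (at y)) \<Longrightarrow> continuous_on UNIV p' \<Longrightarrow> p 0 = 0 \<Longrightarrow>
      (\<And>y. p' y \<le> B) \<Longrightarrow> (LINT x|M01. Z x * p (V x)) \<le> B * (LINT x|M01. Z x * V x)"
      using P_range_representative[OF \<open>0 < \<nu>\<close> v] by blast
    note sV = sq_integrable_continuous[OF cV] and sZ = sq_integrable_continuous[OF cZ]
    have rep: "AE x in M01. rep_L2 (v + w t) x = V x + rep_L2 (w t) x"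
      using rep_L2_add_AE[of v "w t"] rep_L2_AE[OF sV, folded vV] by eventually_elim simp
    have wt: "w t \<in> H_space \<nu> 1" using w t by (simp add: C_space_def)
    obtain BV where BV: "\<And>x. x \<in> {0..1} \<Longrightarrow> \<bar>V x\<bar> \<le> BV"
      using compact_imp_bounded[OF compact_continuous_image[OF cV compact_Icc]]
      unfolding bounded_real by blast
    have "AE x in M01. x \<in> {0<..<1}"
      by (rule AE_I2) (simp add: space_restrict_space)
    with rep H1_Linf_norm(1)[OF \<open>0 < \<nu>\<close> wt] have "AE x in M01. \<bar>rep_L2 (v + w t) x\<bar> \<le> BV + Linf_norm (w t)"
    proof eventually_elim
      case (elim x)
      then show ?case using BV[of x] by simp
    qed
    then have L6: "v + w t \<in> L6" by (rule L6_I)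
    define f where "f x = (\<Sum>k=0..3. a k * rep_L2 (v + w t) x ^ k)" for x
    have sf: "sq_integrable f" unfolding f_def by (rule sq_integrable_F[OF L6])
    have Ff: "F a (v + w t) = abs_L2 f" using L6 by (simp add: F_def f_def[abs_def])
    have i1: "H_inner \<nu> (1/2) v (P N (F a (v + w t))) = (LINT x|M01. Z x * f x)"
      by (simp only: H_inner_half_P[OF v] vZ Ff inner_abs_L2[OF sZ sf])
    have i2: "inner v (F a (v + w t)) = (LINT x|M01. V x * f x)"
      by (simp only: Ff) (simp only: vV inner_abs_L2[OF sV sf])
    have n1: "(H_norm \<nu> 1 v)\<^sup>2 = (LINT x|M01. (Z x)\<^sup>2)"
      by (simp add: H_norm_eq vZ power2_norm_eq_inner inner_abs_L2[OF sZ sZ] flip: power2_eq_square)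
    have n0: "(norm v)\<^sup>2 = (LINT x|M01. (V x)\<^sup>2)"
      by (simp add: vV power2_norm_eq_inner inner_abs_L2[OF sV sV] flip: power2_eq_square)
    have "P N v = v" using v P_P by auto
    then have "(H_norm \<nu> (1/2) v)\<^sup>2 = H_inner \<nu> (1/2) v (P N v)"
      by (simp add: H_norm_def H_inner_def)
    also have "\<dots> = (LINT x|M01. Z x * V x)"
      by (simp only: H_inner_half_P[OF v] vZ) (simp only: vV inner_abs_L2[OF sZ sV])
    finally have n2: "(H_norm \<nu> (1/2) v)\<^sup>2 = (LINT x|M01. Z x * V x)" .
    \<comment> \<open>The constant term is left to the remainder, because integration by parts needs a function vanishing at zero.\<close>
    define p where "p y = a 1 * y + a 2 * y\<^sup>2 + a 3 * y ^ 3" for y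
    have "(LINT x|M01. Z x * p (V x)) \<le> B * (LINT x|M01. Z x * V x)"
    proof (rule parts)
      show "(p has_real_derivative a 1 + 2 * a 2 * y + 3 * a 3 * y\<^sup>2) (at y)" for y
        unfolding p_def by (auto intro!: derivative_eq_intros)
      show "a 1 + 2 * a 2 * y + 3 * a 3 * y\<^sup>2 \<le> B" for y
        unfolding B_def using \<open>a 3 \<le> 0\<close> a2 by (rule cubic_derivative_upper_bound)
    qed (auto simp: p_def intro!: continuous_intros)
    note parts' = this[folded n2]
    have cp: "continuous_on {0..1} (\<lambda>x. p (V x))"
      unfolding p_def by (intro continuous_intros cV)
    have int: "integrable M01 (\<lambda>x. Z x * f x)" "integrable M01 (\<lambda>x. V x * f x)"
      "integrable M01 (\<lambda>x. (Z x)\<^sup>2)" "integrable M01 (\<lambda>x. (V x)\<^sup>2)" "integrable M01 (\<lambda>x. Z x * p (V x))"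
      using sq_integrable_mult[OF sZ sf] sq_integrable_mult[OF sV sf] sV sZ
        sq_integrable_mult[OF sZ sq_integrable_continuous[OF cp]]
      by (auto simp: sq_integrable_def)
    have "(LINT x|M01. Z x * f x + c * K * (V x * f x))
        \<le> (LINT x|M01. \<epsilon> * (Z x)\<^sup>2 + Z x * p (V x) + c * K * (\<bar>a 0\<bar> + 3 * \<bar>a 1\<bar> / 2) * (V x)\<^sup>2 + C * K\<^sup>2)"
    proof (rule integral_mono_AE)
      show "AE x in M01. Z x * f x + c * K * (V x * f x)
        \<le> \<epsilon> * (Z x)\<^sup>2 + Z x * p (V x) + c * K * (\<bar>a 0\<bar> + 3 * \<bar>a 1\<bar> / 2) * (V x)\<^sup>2 + C * K\<^sup>2"
        using rep S(1)
      proof eventually_elim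
        case (elim x)
        define r where "r = rep_L2 (w t) x"
        have "f x = a 0 + a 1 * (V x + r) + a 2 * (V x + r)\<^sup>2 + a 3 * (V x + r) ^ 3"
          unfolding f_def elim(1) r_def by (simp add: eval_nat_numeral)
        moreover have "1 + r ^ 4 \<le> K" using elim(2) by (simp add: K_def r_def)
        ultimately show ?case
          using pointwise[of r K "Z x" "V x"] by (simp only: p_def)
      qed
    qed (use int in simp_all)
    also have "\<dots> = \<epsilon> * (LINT x|M01. (Z x)\<^sup>2) + (LINT x|M01. Z x * p (V x))
        + c * K * (\<bar>a 0\<bar> + 3 * \<bar>a 1\<bar> / 2) * (LINT x|M01. (V x)\<^sup>2) + C * K\<^sup>2"
      using int by (simp add: space_restrict_space)
    also have "(LINT x|M01. Z x * f x + c * K * (V x * f x))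
        = (LINT x|M01. Z x * f x) + c * K * (LINT x|M01. V x * f x)"
      using int by simp
    also have "C * K\<^sup>2 \<le> C * (2 * (S8 + 1))"
      using K2 C by (intro mult_left_mono) auto
    also have "C * (2 * (S8 + 1)) = 2 * C * (S8 + 1)"
      by simp
    also note parts'
    finally have "(LINT x|M01. Z x * f x) + c * K * (LINT x|M01. V x * f x)
        \<le> \<epsilon> * (LINT x|M01. (Z x)\<^sup>2) + B * (H_norm \<nu> (1/2) v)\<^sup>2
        + c * K * (\<bar>a 0\<bar> + 3 * \<bar>a 1\<bar> / 2) * (LINT x|M01. (V x)\<^sup>2) + 2 * C * (S8 + 1)"
      by simp
    then show "H_inner \<nu> (1/2) v (P N (F a (v + w t)))
      + c * ((SUP s\<in>{0..T}. Linf_norm (w s) ^ 4) + 1) * inner v (F a (v + w t))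
    \<le> \<epsilon> * (H_norm \<nu> 1 v)\<^sup>2
      + (\<bar>a 1\<bar> + \<bar>a 2\<bar>\<^sup>2 / (3 * \<bar>a 3\<bar> + indicator {0} (a 3))) * (H_norm \<nu> (1/2) v)\<^sup>2
      + c * ((SUP s\<in>{0..T}. Linf_norm (w s) ^ 4) + 1) * (\<bar>a 0\<bar> + 3 * \<bar>a 1\<bar> / 2) * (norm v)\<^sup>2
      + 2 * C * ((SUP s\<in>{0..T}. Linf_norm (w s) ^ 8) + 1)"
      by (simp only: i1 i2 n1 n0 flip: S4_def S8_def K_def B_def)
  qed
qed

end
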